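(* Let $X\subseteq[0,1]^2$ be a nonempty closed set. Then the MV-algebra $\mathcal M(X)$ is not strongly semisimple if and only if there are a rational point $x\in X$ and a unit vector $u\in\mathbb R^2$ such that $u$ is a rational vector and $u$ is an outgoing Bouligand-Severi tangent vector to $X$ at $x$.
   Context: An MV-algebra is an algebra $(A,\oplus,\neg,0)$ such that $(A,\oplus,0)$ is a commutative monoid, $\neg\neg a=a$, $a\oplus\neg 0=\neg 0$, and $\neg(\neg a\oplus b)\oplus b=\neg(\neg b\oplus a)\oplus a$ for all $a,b\in A$. Its natural order is given by $a\le b$ iff $\neg a\oplus b=\neg 0$. An ideal of $A$ is a subset containing $0$, closed under $\oplus$, and downward closed for $\le$. An ideal $I$ is proper if $I\neq A$, and maximal if it is maximal among the proper ideals. The quotient $A/I$ is the quotient by the congruence $a\sim b$ iff $\neg(\neg a\oplus b)\oplus\neg(\neg b\oplus a)\in I$. The principal ideal generated by $g\in A$ is $\{a\in A\mid a\le g\oplus\cdots\oplus g \ (k \text{ summands}) \text{ for some } k\ge 0\}$ (the empty sum being $0$). $A$ is semisimple if the intersection of all its maximal ideals is $\{0\}$ (with the empty intersection equal to $A$, so that the trivial one-element algebra counts as semisimple). $A$ is strongly semisimple if for every principal ideal $I$ of $A$ the quotient $A/I$ is semisimple. A McNaughton function on $[0,1]^2$ is a continuous function $f\colon[0,1]^2\to[0,1]$ for which there are finitely many affine functions $p_1,\dots,p_k\colon\mathbb R^2\to\mathbb R$ with integer coefficients (including the constant term) such that for every $x\in[0,1]^2$ there is $i$ with $f(x)=p_i(x)$.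 $\mathcal M([0,1]^2)$ is the MV-algebra of all McNaughton functions on $[0,1]^2$ with the pointwise operations $\neg a=1-a$ and $a\oplus b=\min(1,a+b)$. For nonempty closed $X\subseteq[0,1]^2$, $\mathcal M(X)=\{f|_X\mid f\in\mathcal M([0,1]^2)\}$, with the same pointwise operations. Let $X\subseteq\mathbb R^2$ be closed, $x\in X$, and $u\in\mathbb R^2$ a unit vector (Euclidean norm $\|\cdot\|$). $u$ is a Bouligand-Severi tangent vector to $X$ at $x$ if there is a sequence $x_0,x_1,\dots$ of elements of $X$, all different from $x$, with $\lim_{i\to\infty}x_i=x$ and $\lim_{i\to\infty}(x_i-x)/\|x_i-x\|=u$. Such a $u$ is outgoing if for some $\lambda>0$ the segment $\operatorname{conv}(x,x+\lambda u)$ intersects $X$ only at $x$. A point of $\mathbb R^2$ is rational if both its coordinates are rational. A nonzero vector $w\in\mathbb R^2$ is rational if the line $\mathbb Rw$ contains at least two rational points. *)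

theory Defs
  imports "HOL-Analysis.Analysis"
begin

section \<open>MV-algebras\<close>

record 'a mv_struct =
  carrier :: "'a set"
  mv_plus :: "'a \<Rightarrow> 'a \<Rightarrow> 'a" (infixl "\<oplus>\<index>" 65)
  mv_neg :: "'a \<Rightarrow> 'a" ("\<sim>\<index> _" [81] 80)
  mv_zero :: 'a ("\<zero>\<index>")

locale mv_algebra =
  fixes A :: "('a, 'm) mv_struct_scheme" (structure)
  assumes plus_closed: "\<lbrakk>a \<in> carrier A; b \<in> carrier A\<rbrakk> \<Longrightarrow> a \<oplus> b \<in> carrier A"
    and neg_closed: "a \<in> carrier A \<Longrightarrow> \<sim> a \<in> carrier A"
    and zero_closed: "\<zero> \<in> carrier A"
    and plus_assoc:
      "\<lbrakk>a \<in> carrier A; b \<in> carrier A; c \<in> carrier A\<rbrakk> \<Longrightarrow> (a \<oplus> b) \<oplus> c = a \<oplus> (b \<oplus> c)"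
    and plus_commute: "\<lbrakk>a \<in> carrier A; b \<in> carrier A\<rbrakk> \<Longrightarrow> a \<oplus> b = b \<oplus> a"
    and plus_zero: "a \<in> carrier A \<Longrightarrow> a \<oplus> \<zero> = a"
    and neg_neg: "a \<in> carrier A \<Longrightarrow> \<sim> (\<sim> a) = a"
    and plus_neg_zero: "a \<in> carrier A \<Longrightarrow> a \<oplus> \<sim> \<zero> = \<sim> \<zero>"
    and lukasiewicz:
      "\<lbrakk>a \<in> carrier A; b \<in> carrier A\<rbrakk> \<Longrightarrow> \<sim> (\<sim> a \<oplus> b) \<oplus> b = \<sim> (\<sim> b \<oplus> a) \<oplus> a"

definition mv_le :: "('a, 'm) mv_struct_scheme \<Rightarrow> 'a \<Rightarrow> 'a \<Rightarrow> bool" (infix "\<preceq>\<index>" 50)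
  where "a \<preceq>\<^bsub>A\<^esub> b \<longleftrightarrow> \<sim>\<^bsub>A\<^esub> a \<oplus>\<^bsub>A\<^esub> b = \<sim>\<^bsub>A\<^esub> \<zero>\<^bsub>A\<^esub>"

definition mv_ideal :: "('a, 'm) mv_struct_scheme \<Rightarrow> 'a set \<Rightarrow> bool"
  where "mv_ideal A I \<longleftrightarrow>
    I \<subseteq> carrier A \<and> \<zero>\<^bsub>A\<^esub> \<in> I \<and>
    (\<forall>a\<in>I. \<forall>b\<in>I. a \<oplus>\<^bsub>A\<^esub> b \<in> I) \<and>
    (\<forall>b\<in>I. \<forall>a\<in>carrier A. a \<preceq>\<^bsub>A\<^esub> b \<longrightarrow> a \<in> I)"

definition mv_proper_ideal :: "('a, 'm) mv_struct_scheme \<Rightarrow> 'a set \<Rightarrow> bool"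
  where "mv_proper_ideal A I \<longleftrightarrow> mv_ideal A I \<and> I \<noteq> carrier A"

definition mv_maximal_ideal :: "('a, 'm) mv_struct_scheme \<Rightarrow> 'a set \<Rightarrow> bool"
  where "mv_maximal_ideal A I \<longleftrightarrow>
    mv_proper_ideal A I \<and> (\<forall>J. mv_proper_ideal A J \<and> I \<subseteq> J \<longrightarrow> J = I)"

definition mv_principal_ideal :: "('a, 'm) mv_struct_scheme \<Rightarrow> 'a \<Rightarrow> 'a set"
  where "mv_principal_ideal A g =
    {a \<in> carrier A. \<exists>k::nat. a \<preceq>\<^bsub>A\<^esub> ((\<lambda>b. g \<oplus>\<^bsub>A\<^esub> b) ^^ k) \<zero>\<^bsub>A\<^esub>}"

definition mv_cong :: "('a, 'm) mv_struct_scheme \<Rightarrow> 'a set \<Rightarrow> ('a \<times> 'a) set"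
  where "mv_cong A I =
    {(a, b). a \<in> carrier A \<and> b \<in> carrier A \<and>
       \<sim>\<^bsub>A\<^esub> (\<sim>\<^bsub>A\<^esub> a \<oplus>\<^bsub>A\<^esub> b) \<oplus>\<^bsub>A\<^esub> \<sim>\<^bsub>A\<^esub> (\<sim>\<^bsub>A\<^esub> b \<oplus>\<^bsub>A\<^esub> a) \<in> I}"

text \<open>The operations on classes are the unions of the classes of the results over all
  representatives; when the relation is a congruence all of these coincide.\<close>

definition mv_quotient :: "('a, 'm) mv_struct_scheme \<Rightarrow> 'a set \<Rightarrow> 'a set mv_struct"
  where "mv_quotient A I =
    \<lparr>carrier = carrier A // mv_cong A I,
     mv_plus = (\<lambda>C D. \<Union>a\<in>C. \<Union>b\<in>D. mv_cong A I `` {a \<oplus>\<^bsub>A\<^esub> b}),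
     mv_neg = (\<lambda>C. \<Union>a\<in>C. mv_cong A I `` {\<sim>\<^bsub>A\<^esub> a}),
     mv_zero = mv_cong A I `` {\<zero>\<^bsub>A\<^esub>}\<rparr>"

text \<open>The intersection is taken inside the carrier, so it is the whole algebra if there is no
  maximal ideal.\<close>

definition mv_semisimple :: "('a, 'm) mv_struct_scheme \<Rightarrow> bool"
  where "mv_semisimple A \<longleftrightarrow>
    {a \<in> carrier A. \<forall>I. mv_maximal_ideal A I \<longrightarrow> a \<in> I} = {\<zero>\<^bsub>A\<^esub>}"

definition mv_strongly_semisimple :: "('a, 'm) mv_struct_scheme \<Rightarrow> bool"
  where "mv_strongly_semisimple A \<longleftrightarrow>
    (\<forall>g\<in>carrier A. mv_semisimple (mv_quotient A (mv_principal_ideal A g)))"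


section \<open>McNaughton functions\<close>

definition int_affine :: "(real^2 \<Rightarrow> real) \<Rightarrow> bool"
  where "int_affine p \<longleftrightarrow>
    (\<exists>a b c :: int. p = (\<lambda>x. of_int a * x$1 + of_int b * x$2 + of_int c))"

text \<open>Here \<open>cbox 0 1\<close> is the unit square. The values of \<open>f\<close> outside it are unconstrained; they
  are discarded by \<open>restrict\<close> below.\<close>

definition mcnaughton :: "(real^2 \<Rightarrow> real) \<Rightarrow> bool"
  where "mcnaughton f \<longleftrightarrow>
    continuous_on (cbox 0 1) f \<and> (\<forall>x\<in>cbox 0 1. 0 \<le> f x \<and> f x \<le> 1) \<and>
    (\<exists>P. finite P \<and> (\<forall>p\<in>P. int_affine p) \<and> (\<forall>x\<in>cbox 0 1. \<exists>p\<in>P. f x = p x))"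

definition mcnaughton_algebra :: "(real^2) set \<Rightarrow> (real^2 \<Rightarrow> real) mv_struct"
  where "mcnaughton_algebra X =
    \<lparr>carrier = {restrict f X | f. mcnaughton f},
     mv_plus = (\<lambda>f g. restrict (\<lambda>x. min 1 (f x + g x)) X),
     mv_neg = (\<lambda>f. restrict (\<lambda>x. 1 - f x) X),
     mv_zero = restrict (\<lambda>x. 0) X\<rparr>"

lemma mcnaughton_zero: "mcnaughton (\<lambda>x. 0)"
proof -
  have "int_affine (\<lambda>x. 0)"
    unfolding int_affine_def by (intro exI[of _ 0]) simp
  then show ?thesis
    unfolding mcnaughton_def by (auto intro!: exI[of _ "{\<lambda>x. 0}"])
qed

lemma mcnaughton_neg:
  assumes "mcnaughton f"
  shows "mcnaughton (\<lambda>x. 1 - f x)"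
proof -
  from assms obtain P where f: "continuous_on (cbox 0 1) f" "\<forall>x\<in>cbox 0 1. 0 \<le> f x \<and> f x \<le> 1"
    and P: "finite P" "\<forall>p\<in>P. int_affine p" "\<forall>x\<in>cbox 0 1. \<exists>p\<in>P. f x = p x"
    unfolding mcnaughton_def by blast
  have aff: "int_affine (\<lambda>x. 1 - p x)" if "int_affine p" for p
  proof -
    from that obtain a b c :: int where "p = (\<lambda>x. of_int a * x$1 + of_int b * x$2 + of_int c)"
      unfolding int_affine_def by blast
    then have "(\<lambda>x. 1 - p x) = (\<lambda>x. of_int (- a) * x$1 + of_int (- b) * x$2 + of_int (1 - c))"
      by (auto simp: algebra_simps)
    then show ?thesis unfolding int_affine_def by blast
  qed
  have "\<exists>Q. finite Q \<and> (\<forall>q\<in>Q. int_affine q) \<and> (\<forall>x\<in>cbox 0 1. \<exists>q\<in>Q. 1 - f x = q x)"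
    using P aff by (intro exI[of _ "(\<lambda>p x. 1 - p x) ` P"]) fastforce
  moreover have "continuous_on (cbox 0 1) (\<lambda>x. 1 - f x)"
    using f by (intro continuous_intros)
  ultimately show ?thesis
    using f unfolding mcnaughton_def by auto
qed

lemma mcnaughton_plus:
  assumes "mcnaughton f" "mcnaughton g"
  shows "mcnaughton (\<lambda>x. min 1 (f x + g x))"
proof -
  from assms(1) obtain P where f: "continuous_on (cbox 0 1) f" "\<forall>x\<in>cbox 0 1. 0 \<le> f x \<and> f x \<le> 1"
    and P: "finite P" "\<forall>p\<in>P. int_affine p" "\<forall>x\<in>cbox 0 1. \<exists>p\<in>P. f x = p x"
    unfolding mcnaughton_def by blast
  from assms(2) obtain Q where g: "continuous_on (cbox 0 1) g" "\<forall>x\<in>cbox 0 1. 0 \<le> g x \<and> g x \<le> 1"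
    and Q: "finite Q" "\<forall>q\<in>Q. int_affine q" "\<forall>x\<in>cbox 0 1. \<exists>q\<in>Q. g x = q x"
    unfolding mcnaughton_def by blast
  let ?R = "insert (\<lambda>x. 1) ((\<lambda>(p, q) x. p x + q x) ` (P \<times> Q))"
  have one: "int_affine (\<lambda>x. 1)"
    unfolding int_affine_def by (intro exI[of _ 0] exI[of _ 1]) simp
  have aff: "int_affine (\<lambda>x. p x + q x)" if "int_affine p" "int_affine q" for p q
  proof -
    from that obtain a b c a' b' c' :: int
      where "p = (\<lambda>x. of_int a * x$1 + of_int b * x$2 + of_int c)"
        and "q = (\<lambda>x. of_int a' * x$1 + of_int b' * x$2 + of_int c')"
      unfolding int_affine_def by blast
    then have "(\<lambda>x. p x + q x) =
        (\<lambda>x. of_int (a + a') * x$1 + of_int (b + b') * x$2 + of_int (c + c'))"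
      by (auto simp: algebra_simps)
    then show ?thesis unfolding int_affine_def by blast
  qed
  have "\<exists>r\<in>?R. min 1 (f x + g x) = r x" if x: "x \<in> cbox 0 1" for x
  proof -
    from P Q x obtain p q where "p \<in> P" "q \<in> Q" "f x = p x" "g x = q x" by blast
    then show ?thesis by (cases "f x + g x \<le> 1") (auto simp: min_def)
  qed
  moreover have "finite ?R" "\<forall>r\<in>?R. int_affine r" using P Q one aff by auto
  ultimately have "\<exists>R. finite R \<and> (\<forall>r\<in>R. int_affine r) \<and>
      (\<forall>x\<in>cbox 0 1. \<exists>r\<in>R. min 1 (f x + g x) = r x)" by meson
  moreover have "continuous_on (cbox 0 1) (\<lambda>x. min 1 (f x + g x))"
    using f g by (intro continuous_intros)
  ultimately show ?thesis
    using f g unfolding mcnaughton_def by auto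
qed

lemma mv_algebra_mcnaughton_algebra:
  assumes "X \<subseteq> cbox 0 1"
  shows "mv_algebra (mcnaughton_algebra X)"
proof -
  let ?C = "{restrict f X | f. mcnaughton f}"
  have bd: "0 \<le> a x" "a x \<le> 1" if "a \<in> ?C" "x \<in> X" for a x
    using that assms unfolding mcnaughton_def by auto
  have undef: "a x = undefined" if "a \<in> ?C" "x \<notin> X" for a x
    using that by auto
  have plus: "restrict (\<lambda>x. min 1 (a x + b x)) X \<in> ?C" if ab: "a \<in> ?C" "b \<in> ?C" for a b
  proof -
    from ab obtain f g where "mcnaughton f" "mcnaughton g" "a = restrict f X" "b = restrict g X"
      by blast
    then show ?thesis
      by (auto intro!: exI[of _ "\<lambda>x. min 1 (f x + g x)"] mcnaughton_plus simp: restrict_def)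
  qed
  have neg: "restrict (\<lambda>x. 1 - a x) X \<in> ?C" if a: "a \<in> ?C" for a
  proof -
    from a obtain f where "mcnaughton f" "a = restrict f X" by blast
    then show ?thesis
      by (auto intro!: exI[of _ "\<lambda>x. 1 - f x"] mcnaughton_neg simp: restrict_def)
  qed
  have zero: "restrict (\<lambda>x. 0) X \<in> ?C" using mcnaughton_zero by blast
  show ?thesis
    unfolding mcnaughton_algebra_def
  proof (unfold_locales; unfold mv_struct.simps)
    fix a b c assume a: "a \<in> ?C" and b: "b \<in> ?C" and c: "c \<in> ?C"
    show "restrict (\<lambda>x. min 1 (restrict (\<lambda>x. min 1 (a x + b x)) X x + c x)) X =
        restrict (\<lambda>x. min 1 (a x + restrict (\<lambda>x. min 1 (b x + c x)) X x)) X"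
      by (rule restrict_ext) (use bd[OF a] bd[OF b] bd[OF c] in \<open>force simp: min_def\<close>)
  next
    fix a assume a: "a \<in> ?C"
    show "restrict (\<lambda>x. min 1 (a x + restrict (\<lambda>x. 0) X x)) X = a"
      using bd[OF a] undef[OF a] by (auto simp: restrict_def fun_eq_iff)
    show "restrict (\<lambda>x. 1 - restrict (\<lambda>x. 1 - a x) X x) X = a"
      using undef[OF a] by (auto simp: restrict_def fun_eq_iff)
    show "restrict (\<lambda>x. min 1 (a x + restrict (\<lambda>x. 1 - restrict (\<lambda>x. 0) X x) X x)) X =
        restrict (\<lambda>x. 1 - restrict (\<lambda>x. 0) X x) X"
      by (rule restrict_ext) (use bd[OF a] in auto)
  next
    fix a b assume a: "a \<in> ?C" and b: "b \<in> ?C"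
    show "restrict (\<lambda>x. min 1 (restrict (\<lambda>x. 1 - restrict (\<lambda>x. min 1
          (restrict (\<lambda>x. 1 - a x) X x + b x)) X x) X x + b x)) X =
        restrict (\<lambda>x. min 1 (restrict (\<lambda>x. 1 - restrict (\<lambda>x. min 1
          (restrict (\<lambda>x. 1 - b x) X x + a x)) X x) X x + a x)) X"
      by (rule restrict_ext) (use bd[OF a] bd[OF b] in \<open>force simp: min_def\<close>)
  qed (use plus neg zero in \<open>simp_all add: add.commute\<close>)
qed


section \<open>Tangents\<close>

definition bouligand_severi_tangent :: "(real^2) set \<Rightarrow> real^2 \<Rightarrow> real^2 \<Rightarrow> bool"
  where "bouligand_severi_tangent X x u \<longleftrightarrow>
    norm u = 1 \<and>
    (\<exists>s :: nat \<Rightarrow> real^2. (\<forall>i. s i \<in> X \<and> s i \<noteq> x) \<and> s \<longlonglongrightarrow> x \<and>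
       (\<lambda>i. (s i - x) /\<^sub>R norm (s i - x)) \<longlonglongrightarrow> u)"

definition outgoing :: "(real^2) set \<Rightarrow> real^2 \<Rightarrow> real^2 \<Rightarrow> bool"
  where "outgoing X x u \<longleftrightarrow> (\<exists>l>0. closed_segment x (x + l *\<^sub>R u) \<inter> X = {x})"

definition rational_point :: "real^2 \<Rightarrow> bool"
  where "rational_point x \<longleftrightarrow> (\<forall>i. x$i \<in> \<rat>)"

definition rational_vector :: "real^2 \<Rightarrow> bool"
  where "rational_vector w \<longleftrightarrow>
    w \<noteq> 0 \<and>
    (\<exists>p q. p \<noteq> q \<and> {p, q} \<subseteq> range (\<lambda>t. t *\<^sub>R w) \<and> rational_point p \<and> rational_point q)"

end

theory Submission
  imports Defs
begin

text \<open>The maximal ideals of a quotient of \<open>M(X)\<close> by the ideal of \<open>g\<close> are given by evaluation at the zeros of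
  \<open>g\<close> in \<open>X\<close>, so strong semisimplicity says that \<open>f \<le> k g\<close> on \<open>X\<close> for some \<open>k\<close> whenever \<open>f\<close> vanishes on the zeros of \<open>g\<close>
  in \<open>X\<close>. If this fails, points \<open>s k\<close> of \<open>X\<close> with \<open>f (s k) > k g (s k)\<close> accumulate at some \<open>x\<close> in a direction
  \<open>u\<close>. Near \<open>x\<close> both functions are positively homogeneous about \<open>x\<close>, which lets the \<open>s k\<close> be pushed out to a fixed
  distance from \<open>x\<close>; in the limit \<open>g\<close> vanishes along \<open>u\<close>. Infinitely many of the points lie on one linear piece
  \<open>p\<close> of \<open>f\<close> and one linear piece \<open>q\<close> of \<open>g\<close>, and these are linearly independent because \<open>p / q\<close> is
  unbounded. Hence \<open>f > 0\<close> along \<open>u\<close>, so \<open>u\<close> is outgoing, and \<open>x\<close> and \<open>u\<close> are rational as the solutions of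
  \<open>p = q = 0\<close> and \<open>q = 0\<close>. Conversely, from an outgoing rational tangent one takes \<open>f\<close> comparable
  to the distance from \<open>x\<close> and \<open>g\<close> to be the distance from a short segment in direction \<open>u\<close>, up to constants.\<close>

section \<open>Algebras of McNaughton functions and their quotients\<close>

lemma image_eq_singleton_iff: "z \<in> f ` S \<Longrightarrow> f ` S = {z} \<longleftrightarrow> (\<forall>a\<in>S. f a = z)"
  by auto

section \<open>Pointwise operations, order and principal ideals of the function algebra\<close>

lemma carrier_mcnaughton_algebra:
  "carrier (mcnaughton_algebra X) = {restrict f X | f. mcnaughton f}"
  by (simp add: mcnaughton_algebra_def)

lemma mcnaughton_algebra_plus_apply:
  "x \<in> X \<Longrightarrow> (a \<oplus>\<^bsub>mcnaughton_algebra X\<^esub> b) x = min 1 (a x + b x)"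
  by (simp add: mcnaughton_algebra_def)

lemma mcnaughton_algebra_neg_apply:
  "x \<in> X \<Longrightarrow> (\<sim>\<^bsub>mcnaughton_algebra X\<^esub> a) x = 1 - a x"
  by (simp add: mcnaughton_algebra_def)

lemma mcnaughton_algebra_zero_apply:
  "x \<in> X \<Longrightarrow> \<zero>\<^bsub>mcnaughton_algebra X\<^esub> x = 0"
  by (simp add: mcnaughton_algebra_def)

lemmas mcnaughton_algebra_apply =
  mcnaughton_algebra_plus_apply mcnaughton_algebra_neg_apply mcnaughton_algebra_zero_apply

lemma mcnaughton_algebra_le_iff:
  "a \<preceq>\<^bsub>mcnaughton_algebra X\<^esub> b \<longleftrightarrow> (\<forall>x\<in>X. a x \<le> b x)"
proof -
  have "a \<preceq>\<^bsub>mcnaughton_algebra X\<^esub> b \<longleftrightarrow> (\<forall>x\<in>X. min 1 (1 - a x + b x) = 1)"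
    by (auto simp: mv_le_def mcnaughton_algebra_def fun_eq_iff restrict_def)
  then show ?thesis by (simp add: min_def)
qed

locale mcnaughton_domain =
  fixes X :: "(real^2) set"
  assumes subset_cube: "X \<subseteq> cbox 0 1"
begin

abbreviation "A \<equiv> mcnaughton_algebra X"

sublocale mv_algebra A
  by (rule mv_algebra_mcnaughton_algebra[OF subset_cube])

lemma carrier_bounds:
  assumes "a \<in> carrier A" "x \<in> X"
  shows "0 \<le> a x" "a x \<le> 1"
proof -
  obtain f where "mcnaughton f" "a = restrict f X"
    using assms(1) by (auto simp: carrier_mcnaughton_algebra)
  moreover have "x \<in> cbox 0 1" using assms(2) subset_cube by blast
  ultimately show "0 \<le> a x" "a x \<le> 1" using assms(2) by (simp_all add: mcnaughton_def)
qed

lemma carrier_continuous: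
  assumes "a \<in> carrier A"
  shows "continuous_on X a"
proof -
  obtain f where f: "mcnaughton f" "a = restrict f X"
    using assms by (auto simp: carrier_mcnaughton_algebra)
  then have "continuous_on X f"
    using subset_cube continuous_on_subset by (auto simp: mcnaughton_def)
  then show ?thesis using f(2) by (simp cong: continuous_on_cong)
qed

text \<open>Because \<open>g\<close> is nonnegative, truncating at \<open>1\<close> after every
  summand agrees with truncating once at the end.\<close>

lemma iterate_plus_apply:
  assumes "g \<in> carrier A" "x \<in> X"
  shows "((\<lambda>b. g \<oplus>\<^bsub>A\<^esub> b) ^^ k) \<zero>\<^bsub>A\<^esub> x = min 1 (of_nat k * g x)"
proof (induction k)
  case (Suc k)
  have "((\<lambda>b. g \<oplus>\<^bsub>A\<^esub> b) ^^ Suc k) \<zero>\<^bsub>A\<^esub> x = min 1 (g x + min 1 (of_nat k * g x))"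
    using Suc assms(2) by (simp add: mcnaughton_algebra_apply)
  also have "\<dots> = min 1 (of_nat (Suc k) * g x)"
    using carrier_bounds(1)[OF assms] by (simp add: min_def algebra_simps)
  finally show ?case .
qed (use assms(2) in \<open>simp add: mcnaughton_algebra_apply\<close>)

lemma iterate_plus_closed:
  "g \<in> carrier A \<Longrightarrow> ((\<lambda>b. g \<oplus>\<^bsub>A\<^esub> b) ^^ k) \<zero>\<^bsub>A\<^esub> \<in> carrier A"
  by (induction k) (simp_all add: zero_closed plus_closed)

text \<open>Elements of the carrier are at most \<open>1\<close>, so the truncation in the
  \<open>k\<close>-fold sum drops out of the bound.\<close>

lemma principal_ideal_iff:
  assumes "g \<in> carrier A"
  shows "a \<in> mv_principal_ideal A g \<longleftrightarrow>
    a \<in> carrier A \<and> (\<exists>k::nat. \<forall>x\<in>X. a x \<le> of_nat k * g x)"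
  unfolding mv_principal_ideal_def mcnaughton_algebra_le_iff
  using carrier_bounds(2) by (simp add: iterate_plus_apply[OF assms] cong: conj_cong)

end

section \<open>The quotient by a principal ideal, computed on representatives\<close>

locale mcnaughton_quotient = mcnaughton_domain +
  fixes g
  assumes generator: "g \<in> carrier A"
begin

abbreviation "R \<equiv> mv_cong A (mv_principal_ideal A g)"
abbreviation "Q \<equiv> mv_quotient A (mv_principal_ideal A g)"
abbreviation "cls a \<equiv> R `` {a}"

lemma generator_nonneg: "x \<in> X \<Longrightarrow> 0 \<le> g x"
  using generator carrier_bounds by blast

text \<open>The two summands of the distance term \<open>?d\<close> are the positive parts of
  \<open>a - b\<close> and \<open>b - a\<close>. At most one is nonzero at each point, so their sum
  is the absolute difference.\<close>

lemma cong_iff: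
  "(a, b) \<in> R \<longleftrightarrow> a \<in> carrier A \<and> b \<in> carrier A \<and>
    (\<exists>k::nat. \<forall>x\<in>X. \<bar>a x - b x\<bar> \<le> of_nat k * g x)"
proof -
  let ?d = "\<sim>\<^bsub>A\<^esub> (\<sim>\<^bsub>A\<^esub> a \<oplus>\<^bsub>A\<^esub> b) \<oplus>\<^bsub>A\<^esub> \<sim>\<^bsub>A\<^esub> (\<sim>\<^bsub>A\<^esub> b \<oplus>\<^bsub>A\<^esub> a)"
  have "?d x = \<bar>a x - b x\<bar>" if "a \<in> carrier A" "b \<in> carrier A" "x \<in> X" for x
    using carrier_bounds[OF that(1,3)] carrier_bounds[OF that(2,3)] that(3)
    by (auto simp: mcnaughton_algebra_apply min_def)
  moreover have "?d \<in> carrier A" if "a \<in> carrier A" "b \<in> carrier A"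
    using that by (intro plus_closed neg_closed)
  ultimately show ?thesis
    unfolding mv_cong_def mem_Collect_eq split_conv principal_ideal_iff[OF generator]
    by (metis (no_types, lifting))
qed

lemma equiv_cong: "equiv (carrier A) R"
proof (rule equivI)
  show "R \<subseteq> carrier A \<times> carrier A" by (auto simp: cong_iff)
  show "refl_on (carrier A) R"
    by (auto simp: refl_on_def cong_iff intro!: exI[of _ 0])
  show "sym R" by (auto simp: sym_def cong_iff abs_minus_commute)
  show "trans R"
  proof (rule transI)
    fix a b c assume "(a, b) \<in> R" "(b, c) \<in> R"
    then obtain k l :: nat where C: "a \<in> carrier A" "c \<in> carrier A"
      and k: "\<forall>x\<in>X. \<bar>a x - b x\<bar> \<le> of_nat k * g x" and l: "\<forall>x\<in>X. \<bar>b x - c x\<bar> \<le> of_nat l * g x"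
      by (auto simp: cong_iff)
    have "\<bar>a x - c x\<bar> \<le> of_nat (k + l) * g x" if "x \<in> X" for x
      using k[rule_format, OF that] l[rule_format, OF that] by (auto simp: algebra_simps)
    then show "(a, c) \<in> R" using C unfolding cong_iff by blast
  qed
qed

lemma cls_eq_iff:
  assumes "a \<in> carrier A" "b \<in> carrier A"
  shows "cls a = cls b \<longleftrightarrow> (\<exists>k::nat. \<forall>x\<in>X. \<bar>a x - b x\<bar> \<le> of_nat k * g x)"
  using eq_equiv_class_iff[OF equiv_cong assms] assms by (simp add: cong_iff)

lemma carrier_quotient: "carrier Q = cls ` carrier A"
  by (auto simp: mv_quotient_def quotient_def)

lemma quotient_zero: "\<zero>\<^bsub>Q\<^esub> = cls \<zero>\<^bsub>A\<^esub>"
  by (simp add: mv_quotient_def)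

text \<open>Negation preserves absolute differences, so the union defining the operation runs over
  equal classes and collapses to one of them.\<close>

lemma quotient_neg:
  assumes "a \<in> carrier A"
  shows "\<sim>\<^bsub>Q\<^esub> (cls a) = cls (\<sim>\<^bsub>A\<^esub> a)"
proof -
  have "cls (\<sim>\<^bsub>A\<^esub> b) = cls (\<sim>\<^bsub>A\<^esub> a)" if "b \<in> cls a" for b
  proof -
    from that obtain k :: nat where b: "b \<in> carrier A" "\<forall>x\<in>X. \<bar>a x - b x\<bar> \<le> of_nat k * g x"
      by (auto simp: cong_iff)
    then show ?thesis
      using assms by (subst cls_eq_iff) (auto simp: neg_closed mcnaughton_algebra_apply)
  qed
  then have "(\<Union>b\<in>cls a. cls (\<sim>\<^bsub>A\<^esub> b)) = cls (\<sim>\<^bsub>A\<^esub> a)"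
    using equiv_class_self[OF equiv_cong assms] by (intro UN_constant_eq[of a]) blast+
  then show ?thesis by (simp add: mv_quotient_def)
qed

text \<open>The error bounds of the two arguments add up, and truncation at \<open>1\<close> cannot
  enlarge a difference. The defining unions are therefore constant, one after the other.\<close>

lemma quotient_plus:
  assumes "a \<in> carrier A" "b \<in> carrier A"
  shows "cls a \<oplus>\<^bsub>Q\<^esub> cls b = cls (a \<oplus>\<^bsub>A\<^esub> b)"
proof -
  have "cls (a' \<oplus>\<^bsub>A\<^esub> b') = cls (a \<oplus>\<^bsub>A\<^esub> b)" if "a' \<in> cls a" "b' \<in> cls b" for a' b'
  proof -
    from that obtain k l :: nat where C: "a' \<in> carrier A" "b' \<in> carrier A"
      and k: "\<forall>x\<in>X. \<bar>a x - a' x\<bar> \<le> of_nat k * g x" and l: "\<forall>x\<in>X. \<bar>b x - b' x\<bar> \<le> of_nat l * g x"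
      by (auto simp: cong_iff)
    have "\<bar>(a' \<oplus>\<^bsub>A\<^esub> b') x - (a \<oplus>\<^bsub>A\<^esub> b) x\<bar> \<le> of_nat (k + l) * g x" if "x \<in> X" for x
      using k[rule_format, OF that] l[rule_format, OF that] that
      by (auto simp: algebra_simps mcnaughton_algebra_apply min_def)
    then show ?thesis
      using assms C by (subst cls_eq_iff) (blast intro: plus_closed)+
  qed
  then have "(\<Union>b'\<in>cls b. cls (a' \<oplus>\<^bsub>A\<^esub> b')) = cls (a \<oplus>\<^bsub>A\<^esub> b)" if "a' \<in> cls a" for a'
    using that equiv_class_self[OF equiv_cong assms(2)] by (intro UN_constant_eq[of b]) blast+
  then have "(\<Union>a'\<in>cls a. \<Union>b'\<in>cls b. cls (a' \<oplus>\<^bsub>A\<^esub> b')) = cls (a \<oplus>\<^bsub>A\<^esub> b)"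
    using equiv_class_self[OF equiv_cong assms(1)] by (intro UN_constant_eq[of a]) blast+
  then show ?thesis by (simp add: mv_quotient_def)
qed

lemma quotient_le_iff:
  assumes "a \<in> carrier A" "b \<in> carrier A"
  shows "cls a \<preceq>\<^bsub>Q\<^esub> cls b \<longleftrightarrow> (\<exists>k::nat. \<forall>x\<in>X. a x \<le> b x + of_nat k * g x)"
proof -
  have "cls a \<preceq>\<^bsub>Q\<^esub> cls b \<longleftrightarrow> cls (\<sim>\<^bsub>A\<^esub> a \<oplus>\<^bsub>A\<^esub> b) = cls (\<sim>\<^bsub>A\<^esub> \<zero>\<^bsub>A\<^esub>)"
    using assms by (simp add: mv_le_def quotient_zero quotient_neg quotient_plus neg_closed zero_closed)
  also have "\<dots> \<longleftrightarrow> (\<exists>k::nat. \<forall>x\<in>X. \<bar>(\<sim>\<^bsub>A\<^esub> a \<oplus>\<^bsub>A\<^esub> b) x - (\<sim>\<^bsub>A\<^esub> \<zero>\<^bsub>A\<^esub>) x\<bar> \<le> of_nat k * g x)"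
    using assms by (intro cls_eq_iff plus_closed neg_closed zero_closed)
  also have "\<dots> \<longleftrightarrow> (\<exists>k::nat. \<forall>x\<in>X. a x \<le> b x + of_nat k * g x)"
  proof (rule ex_cong1, rule ball_cong)
    fix k :: nat and x assume x: "x \<in> X"
    \<comment> \<open>The difference on the left is the positive part of \<open>a x - b x\<close>,
      so a nonnegative bound on it is the same as a bound on \<open>a x - b x\<close>.\<close>
    have "0 \<le> of_nat k * g x" using generator_nonneg[OF x] by simp
    then show "\<bar>(\<sim>\<^bsub>A\<^esub> a \<oplus>\<^bsub>A\<^esub> b) x - (\<sim>\<^bsub>A\<^esub> \<zero>\<^bsub>A\<^esub>) x\<bar> \<le> of_nat k * g x \<longleftrightarrow>
        a x \<le> b x + of_nat k * g x"
      using x by (auto simp: mcnaughton_algebra_apply min_def)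
  qed simp
  finally show ?thesis .
qed

section \<open>Ideals and maximal ideals of the quotient\<close>

lemma ideal_quotientD:
  assumes "mv_ideal Q J"
  shows "J \<subseteq> cls ` carrier A" "cls \<zero>\<^bsub>A\<^esub> \<in> J"
    and "\<And>a b. \<lbrakk>a \<in> carrier A; b \<in> carrier A; cls a \<in> J; cls b \<in> J\<rbrakk> \<Longrightarrow> cls (a \<oplus>\<^bsub>A\<^esub> b) \<in> J"
    and "\<And>a b k. \<lbrakk>a \<in> carrier A; b \<in> carrier A; cls b \<in> J;
      \<forall>x\<in>X. a x \<le> b x + of_nat k * g x\<rbrakk> \<Longrightarrow> cls a \<in> J"
proof -
  show "J \<subseteq> cls ` carrier A" "cls \<zero>\<^bsub>A\<^esub> \<in> J"
    using assms by (auto simp: mv_ideal_def carrier_quotient quotient_zero)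
  show "cls (a \<oplus>\<^bsub>A\<^esub> b) \<in> J" if "a \<in> carrier A" "b \<in> carrier A" "cls a \<in> J" "cls b \<in> J" for a b
    using assms that unfolding mv_ideal_def by (metis quotient_plus)
  show "cls a \<in> J" if "a \<in> carrier A" "b \<in> carrier A" "cls b \<in> J"
    "\<forall>x\<in>X. a x \<le> b x + of_nat k * g x" for a b k
  proof -
    have "cls a \<preceq>\<^bsub>Q\<^esub> cls b" using that quotient_le_iff by blast
    then show ?thesis
      using assms that by (auto simp: mv_ideal_def carrier_quotient)
  qed
qed

lemma ideal_quotient_eq_carrier:
  assumes J: "mv_ideal Q J" and a: "a \<in> carrier A" "cls a \<in> J" and ge: "\<forall>x\<in>X. 1 \<le> a x"
  shows "J = carrier Q"
proof
  show "J \<subseteq> carrier Q" using J by (simp add: mv_ideal_def)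
  show "carrier Q \<subseteq> J"
  proof
    fix c assume "c \<in> carrier Q"
    then obtain b where b: "b \<in> carrier A" "c = cls b" by (auto simp: carrier_quotient)
    then have "\<forall>x\<in>X. b x \<le> a x + of_nat 0 * g x"
      using ge carrier_bounds by fastforce
    then show "c \<in> J" using ideal_quotientD(4)[OF J b(1) a] b(2) by blast
  qed
qed

lemma ideal_quotient_iterate:
  assumes "mv_ideal Q J" "a \<in> carrier A" "cls a \<in> J"
  shows "cls (((\<lambda>b. a \<oplus>\<^bsub>A\<^esub> b) ^^ k) \<zero>\<^bsub>A\<^esub>) \<in> J"
proof (induction k)
  case 0
  show ?case using ideal_quotientD(2)[OF assms(1)] by simp
next
  case (Suc k)
  then show ?case
    using ideal_quotientD(3)[OF assms(1,2) iterate_plus_closed[OF assms(2)] assms(3)] by simp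
qed

text \<open>For a zero \<open>x\<close> of \<open>g\<close> in \<open>X\<close> this is the kernel
  of evaluation at \<open>x\<close>, which is then well defined on classes.\<close>

definition vanishing_ideal :: "real^2 \<Rightarrow> (real^2 \<Rightarrow> real) set set"
  where "vanishing_ideal x = cls ` {a \<in> carrier A. a x = 0}"

context
  fixes x assumes x: "x \<in> X" and zero: "g x = 0"
begin

text \<open>Congruent functions differ at \<open>x\<close> by at most a multiple of
  \<open>g x = 0\<close>.\<close>

lemma cls_in_vanishing_ideal_iff:
  assumes "a \<in> carrier A"
  shows "cls a \<in> vanishing_ideal x \<longleftrightarrow> a x = 0"
proof
  assume "cls a \<in> vanishing_ideal x"
  then obtain b where b: "b \<in> carrier A" "b x = 0" "cls a = cls b"
    by (auto simp: vanishing_ideal_def)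
  then obtain k :: nat where "\<forall>y\<in>X. \<bar>a y - b y\<bar> \<le> of_nat k * g y"
    using assms cls_eq_iff by blast
  then have "\<bar>a x - b x\<bar> \<le> 0" using x zero by force
  then show "a x = 0" using b by simp
qed (use assms in \<open>auto simp: vanishing_ideal_def\<close>)

text \<open>A class outside the kernel has a multiple \<open>b\<close> with value exactly
  \<open>1\<close> at \<open>x\<close>. The negation of \<open>b\<close> vanishes at
  \<open>x\<close>, and its sum with \<open>b\<close> is the constant \<open>1\<close>, so no proper
  ideal lies strictly above.\<close>

lemma maximal_vanishing_ideal: "mv_maximal_ideal Q (vanishing_ideal x)"
proof -
  have ideal: "mv_ideal Q (vanishing_ideal x)"
    unfolding mv_ideal_def
  proof (intro conjI ballI impI)
    show "vanishing_ideal x \<subseteq> carrier Q"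
      by (auto simp: vanishing_ideal_def carrier_quotient)
    show "\<zero>\<^bsub>Q\<^esub> \<in> vanishing_ideal x"
      using x by (simp add: quotient_zero cls_in_vanishing_ideal_iff zero_closed mcnaughton_algebra_apply)
    show "c \<oplus>\<^bsub>Q\<^esub> d \<in> vanishing_ideal x" if cd: "c \<in> vanishing_ideal x" "d \<in> vanishing_ideal x" for c d
    proof -
      from cd obtain a b where "a \<in> carrier A" "b \<in> carrier A" "c = cls a" "d = cls b" "a x = 0" "b x = 0"
        by (auto simp: vanishing_ideal_def)
      then show ?thesis
        using x by (simp add: quotient_plus cls_in_vanishing_ideal_iff plus_closed mcnaughton_algebra_apply)
    qed
    show "c \<in> vanishing_ideal x"
      if d: "d \<in> vanishing_ideal x" and c: "c \<in> carrier Q" and le: "c \<preceq>\<^bsub>Q\<^esub> d" for c d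
    proof -
      from c d obtain a b where ab: "a \<in> carrier A" "b \<in> carrier A" "c = cls a" "d = cls b" "b x = 0"
        by (auto simp: vanishing_ideal_def carrier_quotient)
      then obtain k :: nat where "\<forall>y\<in>X. a y \<le> b y + of_nat k * g y"
        using le quotient_le_iff by blast
      then have "a x \<le> 0" using ab(5) zero x by force
      then have "a x = 0" using carrier_bounds[OF ab(1) x] by simp
      then show ?thesis using ab by (simp add: cls_in_vanishing_ideal_iff)
    qed
  qed
  have proper: "vanishing_ideal x \<noteq> carrier Q"
  proof
    assume "vanishing_ideal x = carrier Q"
    then have "cls (\<sim>\<^bsub>A\<^esub> \<zero>\<^bsub>A\<^esub>) \<in> vanishing_ideal x"
      by (simp add: carrier_quotient zero_closed neg_closed)
    then show False
      using x by (simp add: cls_in_vanishing_ideal_iff zero_closed neg_closed mcnaughton_algebra_apply)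
  qed
  have "J = vanishing_ideal x" if J: "mv_proper_ideal Q J" and sub: "vanishing_ideal x \<subseteq> J" for J
  proof (rule ccontr)
    assume "J \<noteq> vanishing_ideal x"
    moreover have JI: "mv_ideal Q J" using J by (simp add: mv_proper_ideal_def)
    ultimately obtain a where a: "a \<in> carrier A" "cls a \<in> J" "cls a \<notin> vanishing_ideal x"
      using sub ideal_quotientD(1)[OF JI] by blast
    then have "0 < a x"
      using carrier_bounds[OF a(1) x] by (force simp: cls_in_vanishing_ideal_iff)
    then obtain n :: nat where n: "1 < of_nat n * a x"
      using reals_Archimedean3 by blast
    define b where "b = ((\<lambda>b. a \<oplus>\<^bsub>A\<^esub> b) ^^ n) \<zero>\<^bsub>A\<^esub>"
    have b: "b \<in> carrier A" "cls b \<in> J" "b x = 1"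
      using n a ideal_quotient_iterate[OF JI] iterate_plus_apply[OF a(1) x]
      by (auto simp: b_def iterate_plus_closed)
    then have "cls (\<sim>\<^bsub>A\<^esub> b) \<in> J"
      using x sub by (force simp: cls_in_vanishing_ideal_iff neg_closed mcnaughton_algebra_apply)
    then have "cls (b \<oplus>\<^bsub>A\<^esub> \<sim>\<^bsub>A\<^esub> b) \<in> J"
      using b ideal_quotientD(3)[OF JI] by (simp add: neg_closed)
    moreover have "\<forall>y\<in>X. 1 \<le> (b \<oplus>\<^bsub>A\<^esub> \<sim>\<^bsub>A\<^esub> b) y"
      by (simp add: mcnaughton_algebra_apply)
    ultimately have "J = carrier Q"
      using b by (intro ideal_quotient_eq_carrier[OF JI]) (auto intro: plus_closed neg_closed)
    then show False using J by (simp add: mv_proper_ideal_def)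
  qed
  then show ?thesis
    using ideal proper by (auto simp: mv_maximal_ideal_def mv_proper_ideal_def)
qed

end

text \<open>A compactness argument: without a common zero, finitely many members exceed
  \<open>1/2\<close> on open sets covering \<open>X\<close>. A member dominating them exceeds
  \<open>1/2\<close> on all of \<open>X\<close>, and its double is the unit.\<close>

lemma proper_ideal_common_zero:
  assumes "closed X" and J: "mv_proper_ideal Q J"
  obtains x where "x \<in> X" "\<And>a. \<lbrakk>a \<in> carrier A; cls a \<in> J\<rbrakk> \<Longrightarrow> a x = 0"
proof (rule ccontr)
  assume *: "\<not> thesis"
  note common = that
  have JI: "mv_ideal Q J" using J by (simp add: mv_proper_ideal_def)
  have "compact X"
    using assms(1) subset_cube by (meson bounded_cbox bounded_subset compact_eq_bounded_closed)
  define T where "T = {a \<in> carrier A. cls a \<in> J}"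
  \<comment> \<open>The condition says \<open>a x > 1/2\<close>. A positive value reaches
    \<open>1\<close> after finitely many additions, and the strict bound is an open
    condition.\<close>
  have bigger: "\<exists>a\<in>T. 1 < a x + a x" if x: "x \<in> X" for x
  proof -
    from * that obtain a where a: "a \<in> T" "a x \<noteq> 0"
      unfolding T_def using common[OF x] by blast
    then have "0 < a x" using carrier_bounds[of a x] x by (auto simp: T_def)
    then obtain n :: nat where n: "1 < of_nat n * a x" using reals_Archimedean3 by blast
    have "((\<lambda>b. a \<oplus>\<^bsub>A\<^esub> b) ^^ n) \<zero>\<^bsub>A\<^esub> \<in> T" (is "?b \<in> T")
      using a ideal_quotient_iterate[OF JI] by (auto simp: T_def iterate_plus_closed)
    moreover have "1 < ?b x + ?b x"
      using n a x by (simp add: iterate_plus_apply T_def)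
    ultimately show ?thesis by blast
  qed
  have "\<exists>U. open U \<and> U \<inter> X = a -` {1/2<..} \<inter> X" if "a \<in> T" for a
    using that iffD1[OF continuous_on_open_invariant carrier_continuous] by (simp add: T_def)
  then obtain U where U: "\<And>a. a \<in> T \<Longrightarrow> open (U a) \<and> U a \<inter> X = a -` {1/2<..} \<inter> X" by metis
  have "X \<subseteq> \<Union>(U ` T)"
  proof
    fix x assume x: "x \<in> X"
    then obtain a where a: "a \<in> T" "1 < a x + a x" using bigger by blast
    then have "x \<in> a -` {1/2<..} \<inter> X" using x by simp
    then show "x \<in> \<Union>(U ` T)" using U a by blast
  qed
  then obtain F where F: "F \<subseteq> T" "finite F" "X \<subseteq> \<Union>(U ` F)"
    using compactE_image[OF \<open>compact X\<close>, of T U] U by metis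
  \<comment> \<open>A truncated sum still dominates its summands, because these are at most
    \<open>1\<close>; so \<open>T\<close> is directed.\<close>
  have "\<exists>b\<in>T. \<forall>a\<in>F. \<forall>x\<in>X. a x \<le> b x"
    using F(2,1)
  proof (induction F)
    case empty
    then show ?case using ideal_quotientD(2)[OF JI] zero_closed by (auto simp: T_def)
  next
    case (insert a F)
    then obtain b where b: "b \<in> T" "\<forall>a\<in>F. \<forall>x\<in>X. a x \<le> b x" by auto
    have a: "a \<in> T" using insert by simp
    have "a \<oplus>\<^bsub>A\<^esub> b \<in> T"
      using a b(1) ideal_quotientD(3)[OF JI] by (auto simp: T_def plus_closed)
    moreover have "a x \<le> (a \<oplus>\<^bsub>A\<^esub> b) x \<and> b x \<le> (a \<oplus>\<^bsub>A\<^esub> b) x" if "x \<in> X" for x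
      using a b(1) that carrier_bounds[of a x] carrier_bounds[of b x]
      by (auto simp: T_def mcnaughton_algebra_apply)
    ultimately show ?case using b(2) by (intro bexI[of _ "a \<oplus>\<^bsub>A\<^esub> b"]) (auto, force)
  qed
  then obtain b where b: "b \<in> T" "\<forall>a\<in>F. \<forall>x\<in>X. a x \<le> b x" by blast
  have "1 \<le> (b \<oplus>\<^bsub>A\<^esub> b) x" if x: "x \<in> X" for x
  proof -
    obtain a where a: "a \<in> F" "x \<in> U a" using F(3) x by blast
    then have "1/2 < a x" using U[of a] F(1) x by blast
    then have "1/2 < b x" using b(2) a x by fastforce
    then show ?thesis using x by (simp add: mcnaughton_algebra_apply)
  qed
  then have "J = carrier Q"
    using b(1) ideal_quotient_eq_carrier[OF JI, of "b \<oplus>\<^bsub>A\<^esub> b"] ideal_quotientD(3)[OF JI]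
    by (auto simp: T_def plus_closed)
  then show False using J by (simp add: mv_proper_ideal_def)
qed

text \<open>Every maximal ideal is the vanishing ideal of a zero of \<open>g\<close>: it lies in the
  vanishing ideal of a common zero \<open>x\<close> of its members, and \<open>g\<close> is among
  these members.\<close>

lemma maximal_ideals_contain_iff:
  assumes "closed X" and a: "a \<in> carrier A"
  shows "(\<forall>J. mv_maximal_ideal Q J \<longrightarrow> cls a \<in> J) \<longleftrightarrow> (\<forall>x\<in>X. g x = 0 \<longrightarrow> a x = 0)"
proof (intro iffI ballI allI impI)
  fix x assume *: "\<forall>J. mv_maximal_ideal Q J \<longrightarrow> cls a \<in> J" and x: "x \<in> X" "g x = 0"
  then have "cls a \<in> vanishing_ideal x" using maximal_vanishing_ideal[OF x] by blast
  then show "a x = 0" using cls_in_vanishing_ideal_iff[OF x a] by blast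
next
  fix J assume *: "\<forall>x\<in>X. g x = 0 \<longrightarrow> a x = 0" and J: "mv_maximal_ideal Q J"
  then have JP: "mv_proper_ideal Q J" by (simp add: mv_maximal_ideal_def)
  then have JI: "mv_ideal Q J" by (simp add: mv_proper_ideal_def)
  obtain x where x: "x \<in> X" "\<And>b. \<lbrakk>b \<in> carrier A; cls b \<in> J\<rbrakk> \<Longrightarrow> b x = 0"
    using proper_ideal_common_zero[OF assms(1) JP] by blast
  \<comment> \<open>The function \<open>g\<close> is at most \<open>0 + 1 * g\<close>, so its class
    lies in every ideal.\<close>
  have "cls g \<in> J"
    using ideal_quotientD(4)[OF JI generator zero_closed ideal_quotientD(2)[OF JI], of 1]
    by (simp add: mcnaughton_algebra_apply)
  then have g: "g x = 0" using x(2) generator by blast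
  have "J \<subseteq> vanishing_ideal x"
    using ideal_quotientD(1)[OF JI] x(2) unfolding vanishing_ideal_def by blast
  then have "J = vanishing_ideal x"
    using J maximal_vanishing_ideal[OF x(1) g] by (auto simp: mv_maximal_ideal_def)
  then show "cls a \<in> J"
    using * x(1) g a by (simp add: cls_in_vanishing_ideal_iff)
qed

text \<open>The left condition on \<open>a\<close> puts its class into all maximal ideals; the
  domination by a multiple of \<open>g\<close> says that this class is zero.\<close>

lemma semisimple_quotient_iff:
  assumes "closed X"
  shows "mv_semisimple Q \<longleftrightarrow> (\<forall>a\<in>carrier A. (\<forall>x\<in>X. g x = 0 \<longrightarrow> a x = 0) \<longrightarrow>
    (\<exists>k::nat. \<forall>x\<in>X. a x \<le> of_nat k * g x))"
proof -
  have zero: "cls a = \<zero>\<^bsub>Q\<^esub> \<longleftrightarrow> (\<exists>k::nat. \<forall>x\<in>X. a x \<le> of_nat k * g x)" if "a \<in> carrier A" for a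
    using that carrier_bounds[OF that] 
    by (simp add: quotient_zero cls_eq_iff zero_closed mcnaughton_algebra_apply)
  let ?S = "{a \<in> carrier A. \<forall>x\<in>X. g x = 0 \<longrightarrow> a x = 0}"
  have "{c \<in> carrier Q. \<forall>J. mv_maximal_ideal Q J \<longrightarrow> c \<in> J} = cls ` ?S"
    using maximal_ideals_contain_iff[OF assms] by (auto simp: carrier_quotient)
  moreover have "\<zero>\<^bsub>Q\<^esub> \<in> cls ` ?S"
    using zero_closed by (auto simp: quotient_zero mcnaughton_algebra_apply)
  then have "cls ` ?S = {\<zero>\<^bsub>Q\<^esub>} \<longleftrightarrow> (\<forall>a\<in>?S. cls a = \<zero>\<^bsub>Q\<^esub>)"
    by (rule image_eq_singleton_iff)
  ultimately have "mv_semisimple Q \<longleftrightarrow> (\<forall>a\<in>?S. cls a = \<zero>\<^bsub>Q\<^esub>)"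
    unfolding mv_semisimple_def by simp
  also have "\<dots> \<longleftrightarrow> (\<forall>a\<in>carrier A. (\<forall>x\<in>X. g x = 0 \<longrightarrow> a x = 0) \<longrightarrow> cls a = \<zero>\<^bsub>Q\<^esub>)"
    by blast
  finally show ?thesis by (simp add: zero)
qed

end

text \<open>Only values on \<open>X\<close> enter the domination condition, so restrictions may be
  replaced by McNaughton functions on the whole square.\<close>

lemma strongly_semisimple_mcnaughton_algebra_iff:
  assumes "closed X" "X \<subseteq> cbox 0 1"
  shows "mv_strongly_semisimple (mcnaughton_algebra X) \<longleftrightarrow>
    (\<forall>f g. mcnaughton f \<and> mcnaughton g \<and> (\<forall>x\<in>X. g x = 0 \<longrightarrow> f x = 0) \<longrightarrow>
      (\<exists>k::nat. \<forall>x\<in>X. f x \<le> of_nat k * g x))"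
proof -
  have "mcnaughton_quotient X g" if "g \<in> carrier (mcnaughton_algebra X)" for g
    using assms that by unfold_locales
  from mcnaughton_quotient.semisimple_quotient_iff[OF this assms(1)]
  have "mv_strongly_semisimple (mcnaughton_algebra X) \<longleftrightarrow>
    (\<forall>g\<in>carrier (mcnaughton_algebra X). \<forall>f\<in>carrier (mcnaughton_algebra X).
      (\<forall>x\<in>X. g x = 0 \<longrightarrow> f x = 0) \<longrightarrow> (\<exists>k::nat. \<forall>x\<in>X. f x \<le> of_nat k * g x))"
    by (simp add: mv_strongly_semisimple_def)
  also have "\<dots> \<longleftrightarrow> (\<forall>g. mcnaughton g \<longrightarrow> (\<forall>f. mcnaughton f \<longrightarrow>
      (\<forall>x\<in>X. restrict g X x = 0 \<longrightarrow> restrict f X x = 0) \<longrightarrow>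
      (\<exists>k::nat. \<forall>x\<in>X. restrict f X x \<le> of_nat k * restrict g X x)))"
    unfolding carrier_mcnaughton_algebra by blast
  finally show ?thesis by simp blast
qed

section \<open>Local structure of McNaughton functions\<close>

lemma int_affineE:
  assumes "int_affine p"
  obtains a b c :: int where "p = (\<lambda>x. of_int a * x$1 + of_int b * x$2 + of_int c)"
  using assms unfolding int_affine_def by auto

lemma int_affine_continuous: "int_affine p \<Longrightarrow> continuous_on S p"
  unfolding int_affine_def by (auto intro!: continuous_intros)

lemma int_affine_add_scale:
  assumes "int_affine p" "p x = 0"
  shows "p (x + t *\<^sub>R v) = t * p (x + v)"
proof -
  obtain a b c :: int where p: "p = (\<lambda>x. of_int a * x$1 + of_int b * x$2 + of_int c)"
    using assms(1) by (rule int_affineE)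
  have c: "real_of_int c = - of_int a * x$1 - of_int b * x$2" using assms(2) unfolding p by simp
  show ?thesis unfolding p c by (simp add: algebra_simps)
qed

text \<open>Two distinct common zeros force the determinant \<open>D\<close> of the linear parts to
  vanish. Cross-multiplication expresses proportionality without dividing and so also covers the
  zero function.\<close>

lemma int_affine_two_zeros_proportional:
  assumes "int_affine p" "int_affine q" "p x = 0" "q x = 0" "p y = 0" "q y = 0" "x \<noteq> y"
  shows "p z * q w = p w * q z"
proof -
  obtain a b c :: int where p: "p = (\<lambda>x. of_int a * x$1 + of_int b * x$2 + of_int c)"
    using assms(1) by (rule int_affineE)
  obtain d e f :: int where q: "q = (\<lambda>x. of_int d * x$1 + of_int e * x$2 + of_int f)"
    using assms(2) by (rule int_affineE)
  define D :: real where "D = of_int a * of_int e - of_int b * of_int d"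
  have c: "real_of_int c = - of_int a * x$1 - of_int b * x$2"
    and f: "real_of_int f = - of_int d * x$1 - of_int e * x$2"
    using assms unfolding p q by auto
  have "of_int a * (y$1 - x$1) + of_int b * (y$2 - x$2) = 0"
    "of_int d * (y$1 - x$1) + of_int e * (y$2 - x$2) = 0"
    using assms unfolding p q by (auto simp: algebra_simps)
  then have "D * (y$1 - x$1) = 0" "D * (y$2 - x$2) = 0"
    unfolding D_def by algebra+
  moreover have "y$1 - x$1 \<noteq> 0 \<or> y$2 - x$2 \<noteq> 0"
    using assms(7) by (auto simp: vec_eq_iff forall_2)
  ultimately have "D = 0" by auto
  \<comment> \<open>The other factor is the determinant of the vectors from \<open>x\<close> to
    \<open>z\<close> and to \<open>w\<close>.\<close>
  have "p z * q w - p w * q z = D * ((z$1 - x$1) * (w$2 - x$2) - (z$2 - x$2) * (w$1 - x$1))"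
    unfolding p q c f D_def by (simp add: algebra_simps)
  then show ?thesis using \<open>D = 0\<close> by simp
qed

text \<open>By continuity, the finitely many pieces with a wrong value at \<open>x\<close> do not
  agree with \<open>f\<close> anywhere near \<open>x\<close> and can be discarded.\<close>

lemma mcnaughton_germ:
  assumes f: "mcnaughton f" and x: "x \<in> cbox 0 1"
  obtains P e where "finite P" "0 < e" "\<And>p. p \<in> P \<Longrightarrow> int_affine p \<and> p x = f x"
    "\<And>y. \<lbrakk>y \<in> cbox 0 1; dist y x \<le> e\<rbrakk> \<Longrightarrow> \<exists>p\<in>P. f y = p y"
proof -
  from f obtain P where cont: "continuous_on (cbox 0 1) f"
    and P: "finite P" "\<forall>p\<in>P. int_affine p" "\<forall>x\<in>cbox 0 1. \<exists>p\<in>P. f x = p x"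
    unfolding mcnaughton_def by blast
  define B where "B = {p \<in> P. p x \<noteq> f x}"
  have "\<forall>\<^sub>F y in at x within cbox 0 1. f y \<noteq> p y" if "p \<in> B" for p
  proof -
    have "continuous_on (cbox 0 1) (\<lambda>y. f y - p y)"
      using that P by (intro continuous_on_diff cont int_affine_continuous) (auto simp: B_def)
    then have "((\<lambda>y. f y - p y) \<longlongrightarrow> f x - p x) (at x within cbox 0 1)"
      using x by (simp add: continuous_on_def)
    then have "\<forall>\<^sub>F y in at x within cbox 0 1. f y - p y \<noteq> 0"
      using that by (intro tendsto_imp_eventually_ne) (auto simp: B_def)
    then show ?thesis by simp
  qed
  then have "\<forall>\<^sub>F y in at x within cbox 0 1. \<forall>p\<in>B. f y \<noteq> p y"
    using P(1) by (intro eventually_ball_finite) (auto simp: B_def)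
  then obtain d where d: "0 < d"
    "\<And>y. \<lbrakk>y \<in> cbox 0 1; y \<noteq> x; dist y x < d\<rbrakk> \<Longrightarrow> \<forall>p\<in>B. f y \<noteq> p y"
    unfolding eventually_at by blast
  show thesis
  proof (rule that[of "P - B" "d/2"])
    fix y assume y: "y \<in> cbox 0 1" "dist y x \<le> d/2"
    obtain p where p: "p \<in> P" "f y = p y" using P(3) y(1) by blast
    have "p \<notin> B" using p d(1) d(2)[of y] y by (cases "y = x") (auto simp: B_def)
    then show "\<exists>p\<in>P - B. f y = p y" using p by blast
  qed (use P d(1) in \<open>auto simp: B_def\<close>)
qed

text \<open>Along a ray from a zero the quotient \<open>f (x + t v) / t\<close> is continuous and takes finitely many
  values, hence it is constant.\<close>

lemma mcnaughton_homogeneous_germ: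
  assumes f: "mcnaughton f" and x: "x \<in> cbox 0 1" "f x = 0"
  obtains P e where "finite P" "0 < e" "\<And>p. p \<in> P \<Longrightarrow> int_affine p \<and> p x = 0"
    "\<And>y. \<lbrakk>y \<in> cbox 0 1; dist y x \<le> e\<rbrakk> \<Longrightarrow> \<exists>p\<in>P. f y = p y"
    "\<And>v t. \<lbrakk>x + v \<in> cbox 0 1; norm v \<le> e; 0 \<le> t; t \<le> 1\<rbrakk> \<Longrightarrow> f (x + t *\<^sub>R v) = t * f (x + v)"
proof -
  obtain P e where P: "finite P" "0 < e" "\<And>p. p \<in> P \<Longrightarrow> int_affine p \<and> p x = 0"
    "\<And>y. \<lbrakk>y \<in> cbox 0 1; dist y x \<le> e\<rbrakk> \<Longrightarrow> \<exists>p\<in>P. f y = p y"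
    using mcnaughton_germ[OF f x(1)] x(2) by (metis (no_types, lifting))
  have "f (x + t *\<^sub>R v) = t * f (x + v)"
    if v: "x + v \<in> cbox 0 1" "norm v \<le> e" and t: "0 \<le> t" "t \<le> 1" for v t
  proof (cases "t = 0")
    case False
    have cube: "x + s *\<^sub>R v \<in> cbox 0 1" if "s \<in> {0<..1}" for s
    proof -
      have "(1 - s) *\<^sub>R x + s *\<^sub>R (x + v) \<in> cbox 0 1"
        using that by (intro convexD[OF convex_box(1)] x v) auto
      then show ?thesis by (simp add: algebra_simps)
    qed
    \<comment> \<open>The ratio is studied on the interval without \<open>0\<close>, where division
      would return the default value; the half-open interval is still connected.\<close>
    define h where "h = (\<lambda>s. f (x + s *\<^sub>R v) / s)"
    have "continuous_on (cbox 0 1) f" using f by (simp add: mcnaughton_def)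
    then have "continuous_on {0<..1} (\<lambda>s. f (x + s *\<^sub>R v))"
      by (rule continuous_on_compose2) (use cube in \<open>auto intro!: continuous_intros\<close>)
    then have "continuous_on {0<..1} h"
      unfolding h_def by (intro continuous_intros) auto
    moreover have "h ` {0<..1} \<subseteq> (\<lambda>p. p (x + v)) ` P"
    proof
      fix r assume "r \<in> h ` {0<..1}"
      then obtain s where s: "s \<in> {0<..1}" "r = h s" by blast
      have "s * norm v \<le> e"
        using s(1) v(2) mult_left_le_one_le[of "norm v" s] by auto
      then have "dist (x + s *\<^sub>R v) x \<le> e" using s(1) by (simp add: dist_norm)
      then obtain p where p: "p \<in> P" "f (x + s *\<^sub>R v) = p (x + s *\<^sub>R v)"
        using P(4) cube[OF s(1)] by blast
      then have "f (x + s *\<^sub>R v) = s * p (x + v)" using P(3) int_affine_add_scale by metis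
      then have "r = p (x + v)" using s by (simp add: h_def)
      then show "r \<in> (\<lambda>p. p (x + v)) ` P" using p by blast
    qed
    then have "finite (h ` {0<..1})" using P(1) by (meson finite_imageI finite_subset)
    ultimately have "h constant_on {0<..1}"
      by (intro continuous_finite_range_constant) auto
    then have "h t = h 1" using t False unfolding constant_on_def by force
    then show ?thesis using False by (simp add: h_def field_simps)
  qed (use x in simp)
  then show thesis using that P by blast
qed

text \<open>The factor \<open>s\<close> may exceed \<open>1\<close>, so convexity does not suffice.
  Face constraints active at \<open>x\<close> survive every positive scaling, and the others hold
  within the least positive distance from \<open>x\<close> to a side.\<close>

lemma cube_ray_extend:
  assumes "x \<in> cbox 0 (1 :: real^2)"
  obtains e where "0 < e"
    "\<And>y s. \<lbrakk>y \<in> cbox 0 1; 0 < s; norm (s *\<^sub>R (y - x)) \<le> e\<rbrakk> \<Longrightarrow> x + s *\<^sub>R (y - x) \<in> cbox 0 1"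
proof -
  define E where "E = {r \<in> {x$1, 1 - x$1, x$2, 1 - x$2}. 0 < r}"
  define e where "e = Min (insert 1 E)"
  have fin: "finite E" by (simp add: E_def)
  have e: "0 < e" using fin by (auto simp: e_def E_def)
  have le: "e \<le> r" if "r \<in> E" for r using fin that by (simp add: e_def)
  have "0 \<le> x$i + s * (y$i - x$i) \<and> x$i + s * (y$i - x$i) \<le> 1"
    if y: "y \<in> cbox 0 1" and s: "0 < s" and n: "norm (s *\<^sub>R (y - x)) \<le> e" for y s i
  proof -
    have xi: "0 \<le> x$i" "x$i \<le> 1" "0 \<le> y$i" "y$i \<le> 1" using assms y by (auto simp: mem_box_cart)
    have d: "\<bar>s * (y$i - x$i)\<bar> \<le> e"
      using component_le_norm_cart[of "s *\<^sub>R (y - x)" i] n by simp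
    have "x$i \<in> E" if "x$i \<noteq> 0"
      using that xi exhaust_2[of i] by (auto simp: E_def)
    moreover have "1 - x$i \<in> E" if "x$i \<noteq> 1"
      using that xi exhaust_2[of i] by (auto simp: E_def)
    ultimately have "x$i = 0 \<or> e \<le> x$i" "x$i = 1 \<or> e \<le> 1 - x$i" using le by blast+
    moreover have "0 \<le> s * y$i" "s * (y$i - 1) \<le> 0" using s xi by (auto simp: mult_nonneg_nonpos)
    ultimately show ?thesis using d by auto
  qed
  then show thesis using e that[of e] by (simp add: mem_box_cart)
qed

section \<open>From a failure of semisimplicity to a tangent\<close>

text \<open>Compactness is used twice, first for the points and then for the normalised
  differences.\<close>

lemma subsequence_with_direction:
  fixes s :: "nat \<Rightarrow> 'a::euclidean_space"
  assumes "compact X" "\<And>n. s n \<in> X"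
  obtains x u r where "x \<in> X" "strict_mono (r :: nat \<Rightarrow> nat)" "(s \<circ> r) \<longlonglongrightarrow> x"
    "(\<lambda>n. (s (r n) - x) /\<^sub>R norm (s (r n) - x)) \<longlonglongrightarrow> u"
proof -
  obtain x r1 where x: "x \<in> X" "strict_mono r1" "(s \<circ> r1) \<longlonglongrightarrow> x"
    using assms unfolding compact_def by metis
  define d where "d = (\<lambda>n. (s (r1 n) - x) /\<^sub>R norm (s (r1 n) - x))"
  \<comment> \<open>The closed ball replaces the sphere because the normalised difference is
    \<open>0\<close> when the point equals \<open>x\<close>.\<close>
  have "d n \<in> cball 0 1" for n by (cases "s (r1 n) = x") (simp_all add: d_def)
  then obtain u r2 where u: "strict_mono r2" "(d \<circ> r2) \<longlonglongrightarrow> u"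
    using compact_cball[of "0::'a" 1] unfolding compact_def by metis
  show thesis
  proof (rule that[of x "r1 \<circ> r2" u])
    show "strict_mono (r1 \<circ> r2)" using x u by (simp add: strict_mono_o)
    show "(s \<circ> (r1 \<circ> r2)) \<longlonglongrightarrow> x"
      using LIMSEQ_subseq_LIMSEQ[OF x(3) u(1)] by (simp add: o_assoc)
    show "(\<lambda>n. (s ((r1 \<circ> r2) n) - x) /\<^sub>R norm (s ((r1 \<circ> r2) n) - x)) \<longlonglongrightarrow> u"
      using u(2) by (simp add: d_def o_def)
  qed (rule x)
qed

text \<open>Cramer's rule with integer coefficients. The cross difference in the last hypothesis is
  a multiple of the determinant \<open>D\<close>, so \<open>D\<close> is nonzero.\<close>

lemma rational_point_common_zero:
  assumes "int_affine p" "int_affine q" "p x = 0" "q x = 0" and "p z * q w \<noteq> p w * q z"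
  shows "rational_point x"
proof -
  obtain a b c :: int where p: "p = (\<lambda>x. of_int a * x$1 + of_int b * x$2 + of_int c)"
    using assms(1) by (rule int_affineE)
  obtain d e f :: int where q: "q = (\<lambda>x. of_int d * x$1 + of_int e * x$2 + of_int f)"
    using assms(2) by (rule int_affineE)
  define D where "D = a * e - b * d"
  have c: "real_of_int c = - of_int a * x$1 - of_int b * x$2"
    and f: "real_of_int f = - of_int d * x$1 - of_int e * x$2"
    using assms unfolding p q by auto
  have "p z * q w - p w * q z = of_int D * ((z$1 - x$1) * (w$2 - x$2) - (z$2 - x$2) * (w$1 - x$1))"
    unfolding p q c f D_def by (simp add: algebra_simps)
  then have D: "real_of_int D \<noteq> 0" using assms(5) by auto
  have "of_int D * x$1 = of_int (b * f - c * e)" "of_int D * x$2 = of_int (c * d - a * f)"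
    unfolding D_def of_int_mult of_int_diff c f by (simp_all add: algebra_simps)
  then have "x$1 = of_int (b * f - c * e) / of_int D" "x$2 = of_int (c * d - a * f) / of_int D"
    using D by (simp_all add: field_simps)
  then show ?thesis
    unfolding rational_point_def forall_2 by (metis Rats_divide Rats_of_int)
qed

text \<open>The direction \<open>u\<close> of the zero line of \<open>q\<close> is parallel to the
  integer vector orthogonal to the gradient of \<open>q\<close>.\<close>

lemma rational_vector_two_zeros:
  assumes "int_affine q" "q x = 0" "q (x + t *\<^sub>R u) = 0" "q w \<noteq> 0" "t \<noteq> 0" "norm u = 1"
  shows "rational_vector u"
proof -
  obtain a b c :: int where q: "q = (\<lambda>x. of_int a * x$1 + of_int b * x$2 + of_int c)"
    using assms(1) by (rule int_affineE)
  have "t * (of_int a * u$1 + of_int b * u$2) = 0"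
    using assms(2,3) unfolding q by (simp add: algebra_simps)
  then have u: "of_int a * u$1 + of_int b * u$2 = 0" using assms(5) by simp
  have n: "u$1 * u$1 + u$2 * u$2 = 1"
    using assms(6) by (simp add: norm_vec_def L2_set_def sum_2 power2_eq_square)
  define v :: "real^2" where "v = (\<chi> i. if i = 1 then - of_int b else of_int a)"
  \<comment> \<open>The inner product of \<open>v\<close> with the unit vector \<open>u\<close>,
    hence the coefficient in \<open>v = s u\<close>.\<close>
  define s where "s = of_int a * u$2 - of_int b * u$1"
  have "a \<noteq> 0 \<or> b \<noteq> 0" using assms(2,4) unfolding q by auto
  then have "v \<noteq> 0" by (auto simp: v_def vec_eq_iff forall_2)
  have "s * u$1 = - of_int b" "s * u$2 = of_int a"
    using u n unfolding s_def by algebra+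
  then have "v = s *\<^sub>R u" by (auto simp: v_def vec_eq_iff forall_2)
  moreover have "rational_point v" "rational_point 0"
    by (auto simp: rational_point_def v_def)
  moreover have "0 = 0 *\<^sub>R u" by simp
  ultimately have "{v, 0} \<subseteq> range (\<lambda>t. t *\<^sub>R u)" by blast
  moreover have "u \<noteq> 0" using assms(6) by auto
  ultimately show ?thesis
    unfolding rational_vector_def
    using \<open>v \<noteq> 0\<close> \<open>rational_point v\<close> \<open>rational_point 0\<close> by blast
qed

section \<open>Extraction of an outgoing rational tangent from an unbounded ratio\<close>

lemma outgoing_rational_tangent_if_not_bounded:
  assumes "closed X" "X \<subseteq> cbox 0 1" and f: "mcnaughton f" and g: "mcnaughton g"
    and zeros: "\<And>x. \<lbrakk>x \<in> X; g x = 0\<rbrakk> \<Longrightarrow> f x = 0"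
    and unbounded: "\<And>k::nat. \<exists>x\<in>X. of_nat k * g x < f x"
  obtains x u where "x \<in> X" "rational_point x" "norm u = 1" "rational_vector u"
    "bouligand_severi_tangent X x u" "outgoing X x u"
proof -
  have "compact X"
    using assms(1,2) by (meson bounded_cbox bounded_subset compact_eq_bounded_closed)
  obtain z where z: "\<And>k. z k \<in> X" "\<And>k::nat. of_nat k * g (z k) < f (z k)"
    using unbounded by metis
  obtain x u r where x: "x \<in> X" and r: "strict_mono (r :: nat \<Rightarrow> nat)" "(z \<circ> r) \<longlonglongrightarrow> x"
    and u: "(\<lambda>n. (z (r n) - x) /\<^sub>R norm (z (r n) - x)) \<longlonglongrightarrow> u"
    by (rule subsequence_with_direction[OF \<open>compact X\<close> z(1)])
  define s where "s = z \<circ> r"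
  define d where "d = (\<lambda>n. (s n - x) /\<^sub>R norm (s n - x))"
  have bounds: "0 \<le> f y" "f y \<le> 1" "0 \<le> g y" "g y \<le> 1" if "y \<in> cbox 0 1" for y
    using f g that by (auto simp: mcnaughton_def)
  have s: "s n \<in> X" "s \<longlonglongrightarrow> x" "of_nat n * g (s n) < f (s n)" for n
  proof -
    show "s n \<in> X" "s \<longlonglongrightarrow> x" using z(1) r by (auto simp: s_def)
    have "of_nat n * g (s n) \<le> of_nat (r n) * g (s n)"
      using seq_suble[OF r(1), of n] bounds(3)[of "s n"] \<open>s n \<in> X\<close> assms(2)
      by (intro mult_right_mono) auto
    then show "of_nat n * g (s n) < f (s n)" using z(2)[of "r n"] by (simp add: s_def)
  qed
  have cube: "x \<in> cbox 0 1" "s n \<in> cbox 0 1" for n using x s(1) assms(2) by auto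
  have cont: "continuous_on (cbox 0 1) f" "continuous_on (cbox 0 1) g"
    using f g by (auto simp: mcnaughton_def)
  \<comment> \<open>Since \<open>f \<le> 1\<close>, eventually \<open>g (w n) \<le> 1/n\<close>.
    This serves both for the points \<open>s n\<close> tending to \<open>x\<close> and for the
    pushed-out points below.\<close>
  have small: "g y = 0"
    if y: "y \<in> cbox 0 1" "\<And>n. w n \<in> cbox 0 1" "w \<longlonglongrightarrow> y"
      and w: "\<forall>\<^sub>F n in sequentially. of_nat n * g (w n) \<le> f (w n)" for y w
  proof -
    have "(\<lambda>n. g (w n)) \<longlonglongrightarrow> g y"
      using continuous_on_tendsto_compose[OF cont(2) y(3,1)] y(2) by simp
    moreover have "(\<lambda>n. g (w n)) \<longlonglongrightarrow> 0"
    proof (rule tendsto_sandwich[OF _ _ tendsto_const lim_inverse_n])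
      show "\<forall>\<^sub>F n in sequentially. 0 \<le> g (w n)" using bounds(3) y(2) by simp
      show "\<forall>\<^sub>F n in sequentially. g (w n) \<le> inverse (of_nat n)"
        using w eventually_gt_at_top[of 0]
      proof eventually_elim
        case (elim n)
        then have "of_nat n * g (w n) \<le> 1" using bounds(2)[OF y(2)[of n]] by linarith
        then show ?case using elim by (simp add: field_simps)
      qed
    qed
    ultimately show ?thesis using LIMSEQ_unique by blast
  qed
  have gx: "g x = 0" using less_imp_le[OF s(3)] by (intro small[OF cube s(2)] always_eventually allI)
  then have fx: "f x = 0" using zeros x by blast
  have ne: "s n \<noteq> x" for n using s(3)[of n] fx gx by auto
  have norm_d: "norm (d n) = 1" for n using ne[of n] by (simp add: d_def)
  have d: "d \<longlonglongrightarrow> u" using u by (simp add: d_def s_def)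
  have norm_u: "norm u = 1"
    using tendsto_norm[OF d] by (simp add: norm_d LIMSEQ_const_iff)
  have tangent: "bouligand_severi_tangent X x u"
    unfolding bouligand_severi_tangent_def
    using norm_u s ne d unfolding d_def by blast

  obtain P e1 where P: "finite P" "0 < e1" "\<And>p. p \<in> P \<Longrightarrow> int_affine p \<and> p x = 0"
    "\<And>y. \<lbrakk>y \<in> cbox 0 1; dist y x \<le> e1\<rbrakk> \<Longrightarrow> \<exists>p\<in>P. f y = p y"
    "\<And>v t. \<lbrakk>x + v \<in> cbox 0 1; norm v \<le> e1; 0 \<le> t; t \<le> 1\<rbrakk> \<Longrightarrow> f (x + t *\<^sub>R v) = t * f (x + v)"
    by (rule mcnaughton_homogeneous_germ[OF f cube(1) fx]) blast
  obtain S e2 where S: "finite S" "0 < e2" "\<And>q. q \<in> S \<Longrightarrow> int_affine q \<and> q x = 0"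
    "\<And>y. \<lbrakk>y \<in> cbox 0 1; dist y x \<le> e2\<rbrakk> \<Longrightarrow> \<exists>q\<in>S. g y = q y"
    "\<And>v t. \<lbrakk>x + v \<in> cbox 0 1; norm v \<le> e2; 0 \<le> t; t \<le> 1\<rbrakk> \<Longrightarrow> g (x + t *\<^sub>R v) = t * g (x + v)"
    by (rule mcnaughton_homogeneous_germ[OF g cube(1) gx]) blast
  obtain e3 where e3: "0 < e3"
    "\<And>y s. \<lbrakk>y \<in> cbox 0 1; 0 < s; norm (s *\<^sub>R (y - x)) \<le> e3\<rbrakk> \<Longrightarrow> x + s *\<^sub>R (y - x) \<in> cbox 0 1"
    by (rule cube_ray_extend[OF cube(1)]) blast
  define e where "e = min e1 (min e2 e3)"
  have e: "0 < e" "e \<le> e1" "e \<le> e2" "e \<le> e3" using P(2) S(2) e3(1) by (auto simp: e_def)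

  \<comment> \<open>The point \<open>s n\<close> is pushed along its ray from \<open>x\<close> to
    distance \<open>e\<close>. The result need not lie in \<open>X\<close>, but it stays in the
    square and tends to \<open>y\<close>.\<close>
  define w where "w = (\<lambda>n. x + e *\<^sub>R d n)"
  define y where "y = x + e *\<^sub>R u"
  have w: "w n \<in> cbox 0 1" for n
  proof -
    have "x + (e / norm (s n - x)) *\<^sub>R (s n - x) \<in> cbox 0 1"
      using e ne[of n] by (intro e3(2) cube) auto
    then show ?thesis by (simp add: w_def d_def divide_inverse)
  qed
  have wy: "w \<longlonglongrightarrow> y" unfolding w_def y_def by (intro tendsto_intros d)
  have y: "y \<in> cbox 0 1" using closed_sequentially[OF closed_cbox _ wy] w by blast
  have "y \<noteq> x" using e(1) norm_u by (auto simp: y_def)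
  have small_t: "\<forall>\<^sub>F n in sequentially. norm (s n - x) < e"
    using s(2)[THEN tendstoD, OF e(1)] by (simp add: dist_norm)
  \<comment> \<open>Both functions scale by the same factor, so the inequality between them passes
    from \<open>s n\<close> to \<open>w n\<close>.\<close>
  have scale: "f (s n) = (norm (s n - x) / e) * f (w n) \<and> g (s n) = (norm (s n - x) / e) * g (w n)"
    if "norm (s n - x) < e" for n
  proof -
    have eq: "s n = x + (norm (s n - x) / e) *\<^sub>R (e *\<^sub>R d n)"
      using e(1) ne[of n] by (simp add: d_def)
    have "norm (e *\<^sub>R d n) \<le> e1" "norm (e *\<^sub>R d n) \<le> e2" using e norm_d[of n] by auto
    moreover have "0 \<le> norm (s n - x) / e" "norm (s n - x) / e \<le> 1" using that e(1) by auto
    moreover have "x + e *\<^sub>R d n \<in> cbox 0 1" using w[of n] by (simp add: w_def)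
    ultimately show ?thesis
      using P(5)[of "e *\<^sub>R d n" "norm (s n - x) / e"] S(5)[of "e *\<^sub>R d n" "norm (s n - x) / e"]
      unfolding w_def eq[symmetric] by blast
  qed
  have big: "of_nat n * g (w n) < f (w n)" and pos: "0 < g (w n)" if n: "norm (s n - x) < e" for n
  proof -
    have t: "0 < norm (s n - x) / e" using e(1) ne[of n] by simp
    have "(norm (s n - x) / e) * (of_nat n * g (w n)) < (norm (s n - x) / e) * f (w n)"
      using s(3)[of n] scale[OF n] by (simp add: mult.left_commute)
    then show "of_nat n * g (w n) < f (w n)" using t mult_less_cancel_left_pos by blast
    have "g (s n) \<noteq> 0" using zeros[OF s(1)[of n]] s(3)[of n] by auto
    then show "0 < g (w n)" using scale[OF n] bounds(3)[OF w[of n]] by fastforce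
  qed
  have gy: "g y = 0"
    by (rule small[OF y w wy eventually_mono[OF small_t]]) (rule less_imp_le[OF big])

  \<comment> \<open>Only finitely many pairs of pieces exist, so one pair represents
    \<open>f\<close> and \<open>g\<close> at infinitely many \<open>w n\<close>.\<close>
  have "\<forall>n\<in>UNIV. \<exists>pq\<in>P \<times> S. f (w n) = fst pq (w n) \<and> g (w n) = snd pq (w n)"
  proof
    fix n
    have "dist (w n) x = e" using norm_d[of n] e(1) by (simp add: w_def dist_norm)
    then show "\<exists>pq\<in>P \<times> S. f (w n) = fst pq (w n) \<and> g (w n) = snd pq (w n)"
      using P(4)[OF w[of n]] S(4)[OF w[of n]] e by force
  qed
  from pigeonhole_infinite_rel[OF infinite_UNIV_nat _ this] obtain p q
    where pq: "p \<in> P" "q \<in> S" and inf: "infinite {n. f (w n) = p (w n) \<and> g (w n) = q (w n)}"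
    using P(1) S(1) by auto
  obtain h where h: "strict_mono (h :: nat \<Rightarrow> nat)"
    "\<And>n. f (w (h n)) = p (w (h n))" "\<And>n. g (w (h n)) = q (w (h n))"
    using infinite_enumerate[OF inf] by auto
  have p: "int_affine p" "p x = 0" and q: "int_affine q" "q x = 0" using pq P(3) S(3) by auto
  have wh: "(\<lambda>n. w (h n)) \<longlonglongrightarrow> y" using LIMSEQ_subseq_LIMSEQ[OF wy h(1)] by (simp add: o_def)
  have limit: "k y = k' y"
    if "continuous_on (cbox 0 1) k" "continuous_on (cbox 0 1) k'" "\<And>n. k (w (h n)) = k' (w (h n))"
    for k k' :: "real^2 \<Rightarrow> real"
    using continuous_on_tendsto_compose[OF that(1) wh y] continuous_on_tendsto_compose[OF that(2) wh y]
    by (simp add: w that(3) LIMSEQ_unique)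
  have py: "p y = f y" and qy: "q y = 0"
    using limit[OF cont(1) int_affine_continuous[OF p(1)]]
      limit[OF cont(2) int_affine_continuous[OF q(1)]] h gy by auto

  have "\<forall>\<^sub>F n in sequentially. norm (s (h n) - x) < e"
    using eventually_subseq[OF h(1) small_t] .
  then obtain N where N: "\<And>n. n \<ge> N \<Longrightarrow> norm (s (h n) - x) < e"
    unfolding eventually_sequentially by blast
  \<comment> \<open>The bound for \<open>h n\<close> is weakened to \<open>n\<close>, using
    \<open>n \<le> h n\<close> and the positivity of \<open>q\<close> at these points.\<close>
  have q_pos: "0 < q (w (h n))" and p_gt: "of_nat n * q (w (h n)) < p (w (h n))" if "n \<ge> N" for n
  proof -
    show *: "0 < q (w (h n))" using pos[OF N[OF that]] h by simp
    have "of_nat n * q (w (h n)) \<le> of_nat (h n) * q (w (h n))"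
      using * seq_suble[OF h(1), of n] by (intro mult_right_mono) auto
    then show "of_nat n * q (w (h n)) < p (w (h n))" using big[OF N[OF that]] h by force
  qed
  \<comment> \<open>Otherwise \<open>p\<close> and \<open>q\<close> both vanish at \<open>x\<close>
    and \<open>y\<close> and are proportional, with ratio \<open>K\<close>; but the ratio exceeds
    every natural number along the sequence.\<close>
  have fy: "0 < f y"
  proof (rule ccontr)
    assume "\<not> 0 < f y"
    then have py0: "p y = 0" using py bounds(1)[OF y] by simp
    define K where "K = p (w (h N)) / q (w (h N))"
    obtain n :: nat where n: "N \<le> n" "K \<le> of_nat n"
      using real_arch_simple[of "max K (of_nat N)"] by auto
    have "p (w (h n)) * q (w (h N)) = p (w (h N)) * q (w (h n))"
      using int_affine_two_zeros_proportional[OF p(1) q(1) p(2) q(2) py0 qy] \<open>y \<noteq> x\<close> by metis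
    then have "p (w (h n)) = K * q (w (h n))"
      using q_pos[of N] by (simp add: K_def field_simps)
    also have "\<dots> \<le> of_nat n * q (w (h n))"
      using n q_pos[OF n(1)] by (intro mult_right_mono) auto
    finally show False using p_gt[OF n(1)] by simp
  qed
  show thesis
  proof (rule that[OF x _ norm_u _ tangent])
    \<comment> \<open>Nonproportionality is seen from \<open>p y > 0\<close>, \<open>q y = 0\<close>
      and the positive value of \<open>q\<close> at \<open>w (h N)\<close>.\<close>
    show "rational_point x"
      using q_pos[of N] fy py qy
      by (intro rational_point_common_zero[OF p(1) q(1) p(2) q(2), of y "w (h N)"]) auto
    show "rational_vector u"
      using q_pos[of N] e(1) qy unfolding y_def
      by (intro rational_vector_two_zeros[OF q, of e u "w (h N)"] norm_u) auto
    \<comment> \<open>On the segment both functions are \<open>t\<close> times their value at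
      \<open>y\<close>. Thus \<open>g\<close> vanishes there, and a point of \<open>X\<close> must
      have \<open>t * f y = 0\<close>.\<close>
    have "v = x" if v: "v \<in> X" "v \<in> closed_segment x (x + e *\<^sub>R u)" for v
    proof -
      obtain t where t: "0 \<le> t" "t \<le> 1" "v = (1 - t) *\<^sub>R x + t *\<^sub>R (x + e *\<^sub>R u)"
        using v(2) by (auto simp: closed_segment_def)
      then have vt: "v = x + t *\<^sub>R (e *\<^sub>R u)" by (simp add: algebra_simps)
      have "norm (e *\<^sub>R u) \<le> e1" "norm (e *\<^sub>R u) \<le> e2" using e norm_u by auto
      then have "f v = t * f y" "g v = t * g y"
        using P(5)[of "e *\<^sub>R u" t] S(5)[of "e *\<^sub>R u" t] y t unfolding vt y_def by auto
      then have "t * f y = 0" using zeros[OF v(1)] gy by simp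
      then show ?thesis using fy vt by simp
    qed
    then have "closed_segment x (x + e *\<^sub>R u) \<inter> X = {x}" using x by auto
    then show "outgoing X x u" unfolding outgoing_def using e(1) by blast
  qed
qed

section \<open>From a tangent to a failure of semisimplicity\<close>

lemma mcnaughton_clip:
  assumes "int_affine p"
  shows "mcnaughton (\<lambda>x. max 0 (min 1 (p x)))"
proof -
  have "int_affine (\<lambda>x. 0)" "int_affine (\<lambda>x. 1)"
    unfolding int_affine_def by (intro exI[of _ 0] exI[of _ "_ :: int"], force)+
  moreover have "\<exists>q\<in>{\<lambda>x. 0, \<lambda>x. 1, p}. max 0 (min 1 (p x)) = q x" for x
    by (auto simp: max_def min_def)
  moreover have "continuous_on (cbox 0 1) (\<lambda>x. max 0 (min 1 (p x)))"
    using assms by (intro continuous_intros int_affine_continuous)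
  ultimately show ?thesis
    unfolding mcnaughton_def using assms
    by (intro conjI exI[of _ "{\<lambda>x. 0, \<lambda>x. 1, p}"]) auto
qed

text \<open>The absolute value is the sum of the positive parts of \<open>p\<close> and
  \<open>- p\<close>, at most one of which is nonzero at each point.\<close>

lemma mcnaughton_clip_abs:
  assumes "int_affine p"
  shows "mcnaughton (\<lambda>x. min 1 \<bar>p x\<bar>)"
proof -
  obtain a b c :: int where p: "p = (\<lambda>x. of_int a * x$1 + of_int b * x$2 + of_int c)"
    using assms by (rule int_affineE)
  have "int_affine (\<lambda>x. - p x)"
    unfolding int_affine_def p
    by (intro exI[of _ "- a"] exI[of _ "- b"] exI[of _ "- c"]) (simp add: fun_eq_iff)
  from mcnaughton_plus[OF mcnaughton_clip[OF assms] mcnaughton_clip[OF this]]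
  have "mcnaughton (\<lambda>x. min 1 (max 0 (min 1 (p x)) + max 0 (min 1 (- p x))))" .
  moreover have "(\<lambda>x. min 1 (max 0 (min 1 (p x)) + max 0 (min 1 (- p x)))) = (\<lambda>x. min 1 \<bar>p x\<bar>)"
    by (auto simp: fun_eq_iff max_def min_def)
  ultimately show ?thesis by simp
qed

lemma rational_common_denominator:
  assumes "rational_point x"
  obtains D a b :: int where "0 < D" "of_int D * x$1 = of_int a" "of_int D * x$2 = of_int b"
proof -
  have "x$1 \<in> \<rat>" "x$2 \<in> \<rat>" using assms by (auto simp: rational_point_def)
  then obtain a b c d :: int where "0 < b" "0 < d" "x$1 = of_int a / of_int b" "x$2 = of_int c / of_int d"
    by (metis Rats_cases')
  then show thesis by (intro that[of "b * d" "a * d" "c * b"]) auto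
qed

text \<open>The difference of two rational points on the line is a nonzero multiple of
  \<open>u\<close>. Clearing denominators makes it integral, and a change of sign makes it point the
  same way as \<open>u\<close>.\<close>

lemma rational_direction:
  assumes "rational_vector u"
  obtains m n :: int and c where "0 < c" "of_int m = c * u$1" "of_int n = c * u$2"
proof -
  obtain v w s t where vw: "v \<noteq> w" "v = s *\<^sub>R u" "w = t *\<^sub>R u" "rational_point v" "rational_point w"
    using assms unfolding rational_vector_def by blast
  define y where "y = v - w"
  have "rational_point y" using vw by (auto simp: y_def rational_point_def)
  then obtain D a b :: int where D: "0 < D" "of_int D * y$1 = of_int a" "of_int D * y$2 = of_int b"
    by (rule rational_common_denominator)
  have y: "y = (s - t) *\<^sub>R u" "s \<noteq> t" using vw by (auto simp: y_def algebra_simps)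
  define c where "c = of_int D * (s - t)"
  have c: "c \<noteq> 0" "of_int a = c * u$1" "of_int b = c * u$2"
    using D y by (auto simp: c_def)
  show thesis
  proof (cases "0 < c")
    case True
    then show ?thesis using that c by blast
  next
    case False
    then show ?thesis using that[of "- c" "- a" "- b"] c by simp
  qed
qed

lemma norm_le_sum_abs_2: "norm (v :: real^2) \<le> \<bar>v$1\<bar> + \<bar>v$2\<bar>"
  using norm_le_l1_cart[of v] by (simp add: sum_2)

section \<open>Separating functions for an outgoing rational tangent\<close>

lemma unbounded_if_outgoing_rational_tangent:
  assumes "rational_point x" "rational_vector u"
    and tangent: "bouligand_severi_tangent X x u" and "outgoing X x u"
  obtains f g where "mcnaughton f" "mcnaughton g" "\<And>y. \<lbrakk>y \<in> X; g y = 0\<rbrakk> \<Longrightarrow> f y = 0"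
    "\<And>k::nat. \<exists>y\<in>X. of_nat k * g y < f y"
proof -
  obtain D a b :: int where D: "0 < D" "of_int D * x$1 = of_int a" "of_int D * x$2 = of_int b"
    using assms(1) by (rule rational_common_denominator)
  obtain m n :: int and c where c: "0 < c" "of_int m = c * u$1" "of_int n = c * u$2"
    using assms(2) by (rule rational_direction)
  obtain l where l: "0 < l" "closed_segment x (x + l *\<^sub>R u) \<inter> X = {x}"
    using assms(4) unfolding outgoing_def by blast
  obtain s where s: "\<And>i. s i \<in> X" "\<And>i. s i \<noteq> x" "s \<longlonglongrightarrow> x"
    and su: "(\<lambda>i. (s i - x) /\<^sub>R norm (s i - x)) \<longlonglongrightarrow> u" and "norm u = 1"
    using tangent unfolding bouligand_severi_tangent_def by blast
  have u: "u$1 * u$1 + u$2 * u$2 = 1"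
    using \<open>norm u = 1\<close> by (simp add: norm_vec_def L2_set_def sum_2 power2_eq_square)
  have "0 < of_int D * c * l" using D(1) c(1) l(1) by simp
  \<comment> \<open>With this choice \<open>1/N\<close> lies below the value \<open>D c l\<close>
    that the function \<open>r\<close> below takes at the end \<open>x + l u\<close> of the
    segment.\<close>
  then obtain N :: nat where N: "1 < of_nat N * (of_int D * c * l)"
    using reals_Archimedean3 by blast
  define p1 where "p1 = (\<lambda>y::real^2. of_int D * (y$1 - x$1))"
  define p2 where "p2 = (\<lambda>y::real^2. of_int D * (y$2 - x$2))"
  \<comment> \<open>The line through \<open>x\<close> in direction \<open>u\<close> is the zero set of \<open>q\<close>, and \<open>r (x + t u) = c D t\<close>.\<close>
  define q where "q = (\<lambda>y. of_int n * p1 y - of_int m * p2 y)"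
  define r where "r = (\<lambda>y. of_int m * p1 y + of_int n * p2 y)"
  have p1: "p1 = (\<lambda>y. of_int D * y$1 + of_int 0 * y$2 + of_int (- a))"
    and p2: "p2 = (\<lambda>y. of_int 0 * y$1 + of_int D * y$2 + of_int (- b))"
    using D by (auto simp: p1_def p2_def algebra_simps)
  have q_eq: "q = (\<lambda>y. of_int (n * D) * y$1 + of_int (- m * D) * y$2 + of_int (m * b - n * a))"
    and nr_eq: "(\<lambda>y. - r y) = (\<lambda>y. of_int (- m * D) * y$1 + of_int (- n * D) * y$2 + of_int (m * a + n * b))"
    and Nr_eq: "(\<lambda>y. of_nat N * r y - 1) = (\<lambda>y. of_int (int N * m * D) * y$1
      + of_int (int N * n * D) * y$2 + of_int (- int N * (m * a + n * b) - 1))"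
    unfolding q_def r_def p1 p2 by (auto simp: fun_eq_iff algebra_simps)
  have aff: "int_affine p1" "int_affine p2" "int_affine q" "int_affine (\<lambda>y. - r y)"
    "int_affine (\<lambda>y. of_nat N * r y - 1)"
    unfolding p1 p2 q_eq nr_eq Nr_eq int_affine_def by blast+
  \<comment> \<open>Near \<open>x\<close>, \<open>f\<close> is \<open>D\<close> times the sum of the
    coordinate distances from \<open>x\<close>. The zeros of \<open>g\<close> are given by
    \<open>q = 0\<close> and \<open>0 \<le> r \<le> 1/N\<close>, a segment from \<open>x\<close> in
    direction \<open>u\<close> shorter than \<open>l\<close>.\<close>
  define f where "f = (\<lambda>y. min 1 (min 1 \<bar>p1 y\<bar> + min 1 \<bar>p2 y\<bar>))"
  define g where "g = (\<lambda>y. min 1 (min 1 \<bar>q y\<bar> +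
    min 1 (max 0 (min 1 (- r y)) + max 0 (min 1 (of_nat N * r y - 1)))))"
  have "mcnaughton f" unfolding f_def by (intro mcnaughton_plus mcnaughton_clip_abs aff)
  moreover have "mcnaughton g"
    unfolding g_def by (intro mcnaughton_plus mcnaughton_clip_abs mcnaughton_clip aff)
  moreover have "f y = 0" if y: "y \<in> X" "g y = 0" for y
  proof -
    have q0: "q y = 0" and r0: "0 \<le> r y" "of_nat N * r y \<le> 1"
      using y(2) unfolding g_def by (auto simp: min_def max_def split: if_splits)
    define t where "t = r y / (of_int D * c)"
    have Dc: "0 < of_int D * c" using D c by simp
    have ry: "r y = of_int D * c * (u$1 * (y$1 - x$1) + u$2 * (y$2 - x$2))"
      unfolding r_def p1_def p2_def c by (simp add: algebra_simps)
    have "of_int D * c * (u$2 * (y$1 - x$1) - u$1 * (y$2 - x$2)) = 0"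
      using q0 unfolding q_def p1_def p2_def c by (simp add: algebra_simps)
    then have orth: "u$2 * (y$1 - x$1) - u$1 * (y$2 - x$2) = 0" using Dc by auto
    have t: "t = u$1 * (y$1 - x$1) + u$2 * (y$2 - x$2)" using D(1) c(1) unfolding t_def ry by simp
    \<comment> \<open>Here \<open>y - x\<close> is resolved along \<open>u\<close> and perpendicular
      to it; the perpendicular component is zero by \<open>orth\<close>.\<close>
    have "y$1 = x$1 + t * u$1" "y$2 = x$2 + t * u$2"
      using orth u unfolding t by algebra+
    then have yt: "y = x + t *\<^sub>R u" by (simp add: vec_eq_iff forall_2)
    have "0 \<le> t" unfolding t_def using r0(1) Dc by (intro divide_nonneg_pos)
    have "t \<le> l"
    proof (rule ccontr)
      assume "\<not> t \<le> l"
      then have "of_int D * c * l \<le> of_int D * c * t" using Dc by (intro mult_left_mono) auto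
      also have "\<dots> = r y" using D(1) c(1) by (simp add: t_def)
      finally have "of_nat N * (of_int D * c * l) \<le> of_nat N * r y"
        by (intro mult_left_mono) auto
      then show False using N r0 by linarith
    qed
    then have "y \<in> closed_segment x (x + l *\<^sub>R u)"
      unfolding closed_segment_def yt using \<open>0 \<le> t\<close> l(1)
      by (auto intro!: exI[of _ "t / l"] simp: algebra_simps)
    then have "y = x" using l y by blast
    then show ?thesis by (simp add: f_def p1_def p2_def)
  qed
  moreover have "\<exists>y\<in>X. of_nat k * g y < f y" for k :: nat
  proof -
    define d where "d = (\<lambda>i. (s i - x) /\<^sub>R norm (s i - x))"
    have sd: "s i - x = norm (s i - x) *\<^sub>R d i" for i using s(2)[of i] by (simp add: d_def)
    have d: "(\<lambda>i. d i $ j) \<longlonglongrightarrow> u $ j" for j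
      using su unfolding d_def by (intro tendsto_intros)
    have cont: "(\<lambda>i. p1 (s i)) \<longlonglongrightarrow> p1 x" "(\<lambda>i. p2 (s i)) \<longlonglongrightarrow> p2 x" "(\<lambda>i. r (s i)) \<longlonglongrightarrow> r x"
      unfolding r_def p1_def p2_def by (intro tendsto_intros s(3))+
    \<comment> \<open>This is \<open>k\<close> times the absolute value of \<open>q (s i)\<close>,
      divided by the distance from \<open>s i\<close> to \<open>x\<close>. It tends to
      \<open>0\<close> because \<open>(m, n)\<close> is parallel to \<open>u\<close>.\<close>
    have "(\<lambda>i. of_nat k * \<bar>of_int D * (of_int n * d i $ 1 - of_int m * d i $ 2)\<bar>) \<longlonglongrightarrow>
        of_nat k * \<bar>of_int D * (of_int n * u $ 1 - of_int m * u $ 2)\<bar>"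
      by (intro tendsto_intros d)
    then have "(\<lambda>i. of_nat k * \<bar>of_int D * (of_int n * d i $ 1 - of_int m * d i $ 2)\<bar>) \<longlonglongrightarrow> 0"
      unfolding c by (simp add: mult.commute mult.left_commute)
    then have ev1: "\<forall>\<^sub>F i in sequentially.
        of_nat k * \<bar>of_int D * (of_int n * d i $ 1 - of_int m * d i $ 2)\<bar> < 1"
      by (rule order_tendstoD) simp
    \<comment> \<open>Up to the factor \<open>D\<close> this is \<open>r (s i)\<close> over the
      distance. Its limit \<open>c\<close> is positive, so the points approach on the forward side,
      where the clip of \<open>- r\<close> vanishes.\<close>
    have "(\<lambda>i. of_int m * d i $ 1 + of_int n * d i $ 2) \<longlonglongrightarrow> of_int m * u $ 1 + of_int n * u $ 2"
      by (intro tendsto_intros d)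
    moreover have "of_int m * u $ 1 + of_int n * u $ 2 = c"
      unfolding c using u by algebra
    ultimately have ev2: "\<forall>\<^sub>F i in sequentially. 0 < of_int m * d i $ 1 + of_int n * d i $ 2"
      using c(1) by (simp add: order_tendstoD)
    have "(\<lambda>i. of_nat N * r (s i)) \<longlonglongrightarrow> of_nat N * r x" by (intro tendsto_intros cont)
    then have ev3: "\<forall>\<^sub>F i in sequentially. of_nat N * r (s i) < 1"
      by (rule order_tendstoD) (simp add: r_def p1_def p2_def)
    \<comment> \<open>Ensures that no truncation in \<open>f\<close> is active at
      \<open>s i\<close>.\<close>
    have "(\<lambda>i. \<bar>p1 (s i)\<bar> + \<bar>p2 (s i)\<bar>) \<longlonglongrightarrow> \<bar>p1 x\<bar> + \<bar>p2 x\<bar>" by (intro tendsto_intros cont)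
    then have ev4: "\<forall>\<^sub>F i in sequentially. \<bar>p1 (s i)\<bar> + \<bar>p2 (s i)\<bar> < 1"
      by (rule order_tendstoD) (simp add: p1_def p2_def)
    obtain i where i: "of_nat k * \<bar>of_int D * (of_int n * d i $ 1 - of_int m * d i $ 2)\<bar> < 1"
      "0 < of_int m * d i $ 1 + of_int n * d i $ 2" "of_nat N * r (s i) < 1"
      "\<bar>p1 (s i)\<bar> + \<bar>p2 (s i)\<bar> < 1"
      using eventually_happens'[OF sequentially_bot
          eventually_conj[OF ev1 eventually_conj[OF ev2 eventually_conj[OF ev3 ev4]]]] by blast
    define t where "t = norm (s i - x)"
    have t: "0 < t" using s(2)[of i] by (simp add: t_def)
    have comp: "s i $ j - x $ j = t * d i $ j" for j
      using arg_cong[OF sd[of i], of "\<lambda>v. v $ j"] by (simp add: t_def)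
    have "r (s i) = of_int D * t * (of_int m * d i $ 1 + of_int n * d i $ 2)"
      unfolding r_def p1_def p2_def comp by (simp add: algebra_simps)
    then have r: "0 \<le> r (s i)" using D(1) t i(2) by simp
    have q: "q (s i) = t * (of_int D * (of_int n * d i $ 1 - of_int m * d i $ 2))"
      unfolding q_def p1_def p2_def comp by (simp add: algebra_simps)
    \<comment> \<open>Between the two ends of the segment both clipped terms in \<open>r\<close> are
      zero, and only the term in \<open>q\<close> remains.\<close>
    have "g (s i) \<le> \<bar>q (s i)\<bar>" using r i(3) by (auto simp: g_def min_def max_def)
    then have "of_nat k * g (s i) \<le> of_nat k * \<bar>q (s i)\<bar>" by (intro mult_left_mono) auto
    also have "\<dots> = t * (of_nat k * \<bar>of_int D * (of_int n * d i $ 1 - of_int m * d i $ 2)\<bar>)"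
      unfolding q using t by (simp add: abs_mult)
    also have "\<dots> < t * 1" using i(1) t by (intro mult_strict_left_mono)
    also have "t \<le> \<bar>(s i - x)$1\<bar> + \<bar>(s i - x)$2\<bar>" unfolding t_def by (rule norm_le_sum_abs_2)
    also have "\<dots> \<le> of_int D * (\<bar>(s i - x)$1\<bar> + \<bar>(s i - x)$2\<bar>)"
      using D(1) mult_right_mono[of 1 "of_int D" "\<bar>(s i - x)$1\<bar> + \<bar>(s i - x)$2\<bar>"] by simp
    also have "\<dots> = \<bar>p1 (s i)\<bar> + \<bar>p2 (s i)\<bar>"
      using D(1) by (simp add: p1_def p2_def abs_mult distrib_left)
    also have "\<dots> = f (s i)" using i(4) by (auto simp: f_def min_def)
    finally show ?thesis using s(1) by auto
  qed
  ultimately show thesis by (rule that)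
qed

theorem corollary3p5:
  fixes X :: "(real^2) set"
  assumes "X \<noteq> {}" and "closed X" and "X \<subseteq> cbox 0 1"
  shows "\<not> mv_strongly_semisimple (mcnaughton_algebra X) \<longleftrightarrow>
    (\<exists>x\<in>X. \<exists>u. rational_point x \<and> norm u = 1 \<and> rational_vector u \<and>
       bouligand_severi_tangent X x u \<and> outgoing X x u)"
proof
  assume "\<not> mv_strongly_semisimple (mcnaughton_algebra X)"
  then obtain f g where "mcnaughton f" "mcnaughton g" "\<And>x. \<lbrakk>x \<in> X; g x = 0\<rbrakk> \<Longrightarrow> f x = 0"
    "\<And>k::nat. \<exists>x\<in>X. of_nat k * g x < f x"
    unfolding strongly_semisimple_mcnaughton_algebra_iff[OF assms(2,3)] by (metis not_le)
  from outgoing_rational_tangent_if_not_bounded[OF assms(2,3) this]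
  show "\<exists>x\<in>X. \<exists>u. rational_point x \<and> norm u = 1 \<and> rational_vector u \<and>
       bouligand_severi_tangent X x u \<and> outgoing X x u" by metis
next
  assume "\<exists>x\<in>X. \<exists>u. rational_point x \<and> norm u = 1 \<and> rational_vector u \<and>
       bouligand_severi_tangent X x u \<and> outgoing X x u"
  then obtain f g where "mcnaughton f" "mcnaughton g" "\<And>x. \<lbrakk>x \<in> X; g x = 0\<rbrakk> \<Longrightarrow> f x = 0"
    "\<And>k::nat. \<exists>x\<in>X. of_nat k * g x < f x"
    using unbounded_if_outgoing_rational_tangent by metis
  then show "\<not> mv_strongly_semisimple (mcnaughton_algebra X)"
    unfolding strongly_semisimple_mcnaughton_algebra_iff[OF assms(2,3)] by (metis not_le)
qed

end
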